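(* Let $K$ be a perfect field and let $f$ be an irreducible polynomial of degree $n>2$ over $K$ with Galois group $G=\mathrm{Gal}(K_f/K)$, where $K_f$ is the splitting field of $f$. Let $k$ be a positive integer with $k<n$. Then $G$ is $k$-transitive (on the roots of $f$) if and only if all of the following hold: (1) Every minimal generating set for $f$ over $K$ has cardinality $\geq k$. (2) Every subset $D$ of the set of roots of $f$ of cardinality $\leq k$ satisfies $\delta\notin K(D\setminus\{\delta\})$ for all $\delta\in D$. Also, every such $D$ is contained in some minimal generating set $B$ for $f$ over $K$. (3) If $k\geq 2$, then $r_K(f)=1$ and $s_K(f)=n$. (4) The length of any cluster tower of $f$ is $\geq k$, and the first $k$ terms in its degree sequence are ${}^nP_1,{}^nP_2,\dots,{}^nP_k$. Thus there are at least ${}^nP_{k-1}$ many distinct cluster towers.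
   Context: Fix an algebraic closure $\bar K$ of $K$; $R\subset\bar K$ is the set of roots of $f$, and $K(B)$ is the field generated over $K$ by $B$. Here ${}^nP_j=n(n-1)\cdots(n-j+1)$, with ${}^nP_0=1$. $k$-transitivity: $G$ is $k$-transitive if for any two ordered $k$-tuples of distinct roots $(\alpha_1,\dots,\alpha_k)$ and $(\beta_1,\dots,\beta_k)$ of $f$ there is $\sigma\in G$ with $\sigma(\alpha_i)=\beta_i$ for all $1\le i\le k$. Minimal generating set: $B\subset R$ is a minimal generating set for $f$ over $K$ if $K(B)=K_f$ and $K(A)\neq K_f$ for every $A\subsetneq B$. Clusters: roots $\alpha,\beta\in R$ are equivalent if $K(\alpha)=K(\beta)$ (equality of subfields of $\bar K$); the equivalence classes are the root clusters of $f$. All clusters have the same cardinality, denoted $r_K(f)$, and the number of clusters is $s_K(f)$. Cluster towers: for an ordering $(\beta_1,\dots,\beta_s)$, $s=s_K(f)$, of a complete set of representatives of the clusters, the chain $K\subseteq K(\beta_1)\subseteq K(\beta_1,\beta_2)\subseteq\dots\subseteq K(\beta_1,\dots,\beta_s)=K_f$ is a cluster tower of $f$. Its length is the number of strict inclusions. Its degree sequence is $([L_1:K],[L_2:K],\dots,[K_f:K])$, where $K\subsetneq L_1\subsetneq L_2\subsetneq\dots\subsetneq K_f$ are the distinct fields in the tower. Two cluster towers are equal if their fields are equal at each step, and distinct otherwise. *)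

theory Defs
  imports "HOL-Computational_Algebra.Primes" "HOL-Algebra.Algebraic_Closure" "HOL-Algebra.Generated_Fields" "HOL-Algebra.Bij"
begin

text \<open>
  The ambient structure \<open>L\<close> is an algebraic closure of its subfield \<open>K\<close>; intermediate fields are
  carrier sets contained in \<open>L\<close>.
\<close>

text \<open>
  Perfect: characteristic 0 (the condition is then vacuous), or characteristic \<open>p > 0\<close> and every
  element is a \<open>p\<close>-th power.
\<close>

definition perfect :: "('a, 'm) ring_scheme \<Rightarrow> 'a set \<Rightarrow> bool" where
  "perfect L K \<longleftrightarrow>
     (\<forall>p::nat. Factorial_Ring.prime p \<and> [p] \<cdot>\<^bsub>L\<^esub> \<one>\<^bsub>L\<^esub> = \<zero>\<^bsub>L\<^esub> \<longrightarrow> (\<forall>x\<in>K. \<exists>y\<in>K. y [^]\<^bsub>L\<^esub> p = x))"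

definition adjoin :: "('a, 'm) ring_scheme \<Rightarrow> 'a set \<Rightarrow> 'a set \<Rightarrow> 'a set" where
  "adjoin L K B = generate_field L (K \<union> B)"

definition root_set :: "('a, 'm) ring_scheme \<Rightarrow> 'a list \<Rightarrow> 'a set" where
  "root_set L f = {x. ring.is_root L f x}"

definition splitting_field :: "('a, 'm) ring_scheme \<Rightarrow> 'a set \<Rightarrow> 'a list \<Rightarrow> 'a set" where
  "splitting_field L K f = adjoin L K (root_set L f)"

text \<open>\<open>Bij E\<close> consists of the bijections of \<open>E\<close> that are \<open>undefined\<close> outside \<open>E\<close>.\<close>

definition galois_group :: "('a, 'm) ring_scheme \<Rightarrow> 'a set \<Rightarrow> 'a set \<Rightarrow> ('a \<Rightarrow> 'a) monoid" where
  "galois_group L K E = (BijGroup E)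
     \<lparr>carrier := {\<sigma> \<in> Bij E. \<sigma> \<in> ring_hom (L\<lparr>carrier := E\<rparr>) (L\<lparr>carrier := E\<rparr>)
                         \<and> (\<forall>x\<in>K. \<sigma> x = x)}\<rparr>"

definition k_transitive :: "nat \<Rightarrow> ('a \<Rightarrow> 'a) monoid \<Rightarrow> 'a set \<Rightarrow> bool" where
  "k_transitive k G R \<longleftrightarrow>
     (\<forall>as bs. length as = k \<and> distinct as \<and> set as \<subseteq> R \<and>
              length bs = k \<and> distinct bs \<and> set bs \<subseteq> R \<longrightarrow>
        (\<exists>\<sigma>\<in>carrier G. \<forall>i<k. \<sigma> (as ! i) = bs ! i))"

definition minimal_generating_set ::
    "('a, 'm) ring_scheme \<Rightarrow> 'a set \<Rightarrow> 'a list \<Rightarrow> 'a set \<Rightarrow> bool" where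
  "minimal_generating_set L K f B \<longleftrightarrow>
     B \<subseteq> root_set L f \<and> adjoin L K B = splitting_field L K f \<and>
     (\<forall>A. A \<subset> B \<longrightarrow> adjoin L K A \<noteq> splitting_field L K f)"

definition root_clusters :: "('a, 'm) ring_scheme \<Rightarrow> 'a set \<Rightarrow> 'a list \<Rightarrow> 'a set set" where
  "root_clusters L K f =
     root_set L f // {(\<alpha>, \<beta>). \<alpha> \<in> root_set L f \<and> \<beta> \<in> root_set L f \<and> adjoin L K {\<alpha>} = adjoin L K {\<beta>}}"

definition cluster_size :: "('a, 'm) ring_scheme \<Rightarrow> 'a set \<Rightarrow> 'a list \<Rightarrow> nat" where
  "cluster_size L K f = (THE r. \<forall>C\<in>root_clusters L K f. card C = r)"

definition cluster_number :: "('a, 'm) ring_scheme \<Rightarrow> 'a set \<Rightarrow> 'a list \<Rightarrow> nat" where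
  "cluster_number L K f = card (root_clusters L K f)"

definition cluster_ordering :: "('a, 'm) ring_scheme \<Rightarrow> 'a set \<Rightarrow> 'a list \<Rightarrow> 'a list \<Rightarrow> bool" where
  "cluster_ordering L K f bs \<longleftrightarrow>
     distinct bs \<and> set bs \<subseteq> root_set L f \<and>
     (\<forall>C\<in>root_clusters L K f. \<exists>!\<beta>. \<beta> \<in> set bs \<and> \<beta> \<in> C)"

text \<open>
  A tower is the list of its fields, with repetitions, so that list equality is equality at each
  step. Its first entry is the field generated by \<open>K\<close> alone, that is, \<open>K\<close>.
\<close>

definition tower_of :: "('a, 'm) ring_scheme \<Rightarrow> 'a set \<Rightarrow> 'a list \<Rightarrow> 'a set list" where
  "tower_of L K bs = map (\<lambda>i. adjoin L K (set (take i bs))) [0..<Suc (length bs)]"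

definition cluster_towers :: "('a, 'm) ring_scheme \<Rightarrow> 'a set \<Rightarrow> 'a list \<Rightarrow> 'a set list set" where
  "cluster_towers L K f = {tower_of L K bs | bs. cluster_ordering L K f bs}"

definition tower_length :: "'a set list \<Rightarrow> nat" where
  "tower_length T = card {i. Suc i < length T \<and> T ! i \<subset> T ! Suc i}"

text \<open>
  The fields of a tower increase, so \<open>remdups_adj\<close> lists the distinct ones in order; \<open>tl\<close> drops \<open>K\<close>.
\<close>

definition degree_sequence :: "('a, 'm) ring_scheme \<Rightarrow> 'a set \<Rightarrow> 'a set list \<Rightarrow> nat list" where
  "degree_sequence L K T = map (\<lambda>E. ring.dim L K E) (tl (remdups_adj T))"

definition nPr :: "nat \<Rightarrow> nat \<Rightarrow> nat" where
  "nPr n j = (\<Prod>i<j. n - i)"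

end

theory Submission
  imports Defs
begin

text \<open>
  Let \<open>R\<close> be the set of roots, \<open>|R| = n\<close> by separability. The link between both sides is the
  condition that for every \<open>B \<subseteq> R\<close> with \<open>|B| < k\<close> and every \<open>\<beta> \<in> R - B\<close> the minimal polynomial of
  \<open>\<beta>\<close> over \<open>K(B)\<close> has degree \<open>n - |B|\<close>. The degree is at most \<open>n - |R \<inter> K(B)|\<close> whenever
  \<open>\<beta> \<notin> K(B)\<close>, since \<open>f\<close> is the product of the minimal polynomial and a cofactor vanishing on
  \<open>R \<inter> K(B)\<close>. If \<open>G\<close> is \<open>k\<close>-transitive, automorphisms fixing \<open>B\<close> move \<open>\<beta>\<close> to all of \<open>R - B\<close>, which
  gives equality. Conversely, equality means that the cofactor has no roots outside \<open>B\<close>, so an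
  embedding of \<open>K(B)\<close> extends to \<open>K(B, \<beta>)\<close> with an arbitrary new root as the image of \<open>\<beta>\<close>. Along a
  cluster tower whose degrees start with the numbers \<open>nPr n j\<close>, the same bound forces each of the
  first \<open>k\<close> steps to be strict and to have the degree \<open>n - j\<close>.
\<close>

section \<open>Separability over perfect fields\<close>

lemma (in cring) add_pow_in_subring:
  fixes n :: nat
  assumes "subring H R" "a \<in> H"
  shows "[n] \<cdot> a \<in> H"
  using subringE(2,7)[OF assms(1)] assms(2) by (induct n) auto

lemma (in cring) add_pow_one_mult:
  fixes n :: nat
  assumes "a \<in> carrier R"
  shows "[n] \<cdot> a = ([n] \<cdot> \<one>) \<otimes> a"
  using add_pow_ldistr[of \<one> a n] assms by simp

lemma (in cring) binomial_expansion:
  assumes [simp]: "x \<in> carrier R" "y \<in> carrier R"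
  shows "(x \<oplus> y) [^] (n :: nat) = (\<Oplus>k \<in> {..n}. [(n choose k)] \<cdot> (x [^] k \<otimes> y [^] (n - k)))"
proof (induct n)
  case 0
  show ?case by simp
next
  case (Suc n)
  let ?t = "\<lambda>k. [(n choose k)] \<cdot> (x [^] k \<otimes> y [^] (n - k))"
  let ?u = "\<lambda>k. [(n choose k)] \<cdot> (x [^] Suc k \<otimes> y [^] (n - k))"
  let ?v = "\<lambda>k. [(n choose k)] \<cdot> (x [^] k \<otimes> y [^] (Suc n - k))"
  have x: "(\<Oplus>k \<in> {..n}. ?t k) \<otimes> x = (\<Oplus>k \<in> {..n}. ?u k)"
    by (subst finsum_ldistr)
      (auto simp: add_pow_ldistr add_pow_rdistr m_ac intro!: finsum_cong')
  have y: "(\<Oplus>k \<in> {..n}. ?t k) \<otimes> y = (\<Oplus>k \<in> {..n}. ?v k)"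
    by (subst finsum_ldistr)
      (auto simp: add_pow_ldistr add_pow_rdistr m_ac Suc_diff_le intro!: finsum_cong')
  \<comment> \<open>The term \<open>?v (Suc n)\<close> vanishes since
    \<open>n choose Suc n = 0\<close>, so the range may be enlarged by it before re-indexing. This
    prepares Pascal's rule and isolates \<open>y [^] Suc n\<close>.\<close>
  have v: "(\<Oplus>k \<in> {..n}. ?v k) = (\<Oplus>k \<in> {..n}. ?v (Suc k)) \<oplus> y [^] Suc n"
  proof -
    have "(\<Oplus>k \<in> {..Suc n}. ?v k) = ?v (Suc n) \<oplus> (\<Oplus>k \<in> {..n}. ?v k)"
      by (rule finsum_Suc) simp
    moreover have "(\<Oplus>k \<in> {..Suc n}. ?v k) = (\<Oplus>k \<in> {..n}. ?v (Suc k)) \<oplus> ?v 0"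
      by (rule finsum_Suc2) simp
    ultimately show ?thesis by (simp del: nat_pow_Suc add: finsum_closed binomial_eq_0)
  qed
  have "(\<Oplus>k \<in> {..Suc n}. [(Suc n choose k)] \<cdot> (x [^] k \<otimes> y [^] (Suc n - k)))
      = (\<Oplus>k \<in> {..n}. [(Suc n choose Suc k)] \<cdot> (x [^] Suc k \<otimes> y [^] (n - k))) \<oplus> y [^] Suc n"
    by (subst finsum_Suc2) (simp_all del: nat_pow_Suc)
  also have "(\<Oplus>k \<in> {..n}. [(Suc n choose Suc k)] \<cdot> (x [^] Suc k \<otimes> y [^] (n - k)))
      = (\<Oplus>k \<in> {..n}. ?u k \<oplus> ?v (Suc k))"
    by (rule finsum_cong') (auto simp: add.nat_pow_mult[symmetric] simp del: nat_pow_Suc)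
  also have "\<dots> = (\<Oplus>k \<in> {..n}. ?u k) \<oplus> (\<Oplus>k \<in> {..n}. ?v (Suc k))"
    by (rule finsum_addf) (simp_all del: nat_pow_Suc)
  finally have "(\<Oplus>k \<in> {..Suc n}. [(Suc n choose k)] \<cdot> (x [^] k \<otimes> y [^] (Suc n - k)))
      = (\<Oplus>k \<in> {..n}. ?u k) \<oplus> (\<Oplus>k \<in> {..n}. ?v k)"
    by (simp add: v a_assoc del: nat_pow_Suc)
  also have "\<dots> = (x \<oplus> y) [^] n \<otimes> (x \<oplus> y)"
    unfolding x[symmetric] y[symmetric] Suc[symmetric] by (simp add: r_distr)
  finally show ?case by simp
qed

text \<open>The inner terms of the binomial expansion disappear because a prime divides its inner
  binomial coefficients.\<close>

lemma (in cring) frobenius_hom: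
  assumes "Factorial_Ring.prime (p :: nat)" "[p] \<cdot> \<one> = \<zero>"
  shows "(\<lambda>x. x [^] p) \<in> ring_hom R R"
proof (rule ring_hom_memI)
  fix x y assume [simp]: "x \<in> carrier R" "y \<in> carrier R"
  show "(x \<otimes> y) [^] p = x [^] p \<otimes> y [^] p"
    by (simp add: nat_pow_distrib)
  \<comment> \<open>Writing \<open>p\<close> as \<open>q + 2\<close> makes the two outer terms
    accessible: the inner indices are exactly the \<open>Suc k\<close> with
    \<open>k \<le> q\<close>.\<close>
  obtain q where q: "p = Suc (Suc q)"
    using prime_ge_2_nat[OF assms(1)] that[of "p - 2"] by simp
  let ?t = "\<lambda>k. [(p choose k)] \<cdot> (x [^] k \<otimes> y [^] (p - k))"
  have zero: "?t (Suc k) = \<zero>" if "k \<le> q" for k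
  proof -
    have "p dvd (p choose Suc k)"
      using that q by (intro dvd_choose_prime assms(1)) auto
    then obtain c where "p choose Suc k = p * c" by blast
    then have "[(p choose Suc k)] \<cdot> z = \<zero>" if "z \<in> carrier R" for z
      using that assms(2)
      by (simp add: add_pow_one_mult[of z] add.nat_pow_pow[symmetric])
    then show ?thesis by (simp del: nat_pow_Suc)
  qed
  have split: "(\<Oplus>k \<in> {..Suc (Suc q)}. f k) = f (Suc (Suc q)) \<oplus> ((\<Oplus>k \<in> {..q}. f (Suc k)) \<oplus> f 0)"
    if "range f \<subseteq> carrier R" for f
    using that by (subst finsum_Suc, blast, subst finsum_Suc2) auto
  have "(x \<oplus> y) [^] p = ?t p \<oplus> ((\<Oplus>k \<in> {..q}. ?t (Suc k)) \<oplus> ?t 0)"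
    unfolding binomial_expansion[OF \<open>x \<in> _\<close> \<open>y \<in> _\<close>]
    by (rule split[folded q]) auto
  also have "(\<Oplus>k \<in> {..q}. ?t (Suc k)) = \<zero>"
    by (rule add.finprod_one_eqI) (use zero in auto)
  finally show "(x \<oplus> y) [^] p = x [^] p \<oplus> y [^] p"
    by simp
qed simp_all

text \<open>The witness \<open>p\<close> is the characteristic, taken as the least positive number
  that kills \<open>\<one>\<close>. Division with remainder gives the divisibility; primality comes
  from the absence of zero divisors, applied to \<open>[a] \<cdot> \<one>\<close> and
  \<open>[b] \<cdot> \<one>\<close>.\<close>

lemma (in domain) characteristic_cases:
  fixes n :: nat
  assumes "[n] \<cdot> \<one> = \<zero>" "n > 0"
  obtains p :: nat where "Factorial_Ring.prime p" "[p] \<cdot> \<one> = \<zero>" "\<And>m :: nat. [m] \<cdot> \<one> = \<zero> \<Longrightarrow> p dvd m"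
proof -
  define p where "p = (LEAST m :: nat. m > 0 \<and> [m] \<cdot> \<one> = \<zero>)"
  have p: "p > 0" "[p] \<cdot> \<one> = \<zero>"
    using LeastI[of "\<lambda>m :: nat. m > 0 \<and> [m] \<cdot> \<one> = \<zero>" n] assms unfolding p_def by auto
  have least: "p \<le> m" if "m > 0" "[m] \<cdot> \<one> = \<zero>" for m :: nat
    unfolding p_def using that by (intro Least_le) auto
  have dvd: "p dvd m" if m: "[m] \<cdot> \<one> = \<zero>" for m :: nat
  proof -
    have "[m] \<cdot> \<one> = [(m div p)] \<cdot> ([p] \<cdot> \<one>) \<oplus> [(m mod p)] \<cdot> \<one>"
      by (simp add: add.nat_pow_pow add.nat_pow_mult)
    then have "[(m mod p)] \<cdot> \<one> = \<zero>"
      using m p(2) by simp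
    then show ?thesis
      using least[of "m mod p"] p(1) by (meson mod_less_divisor mod_greater_zero_iff_not_dvd not_less)
  qed
  have "p \<noteq> 1" using p(2) by auto
  have "Factorial_Ring.prime p"
  proof (rule prime_natI)
    show "p \<ge> 2" using p(1) \<open>p \<noteq> 1\<close> by simp
  next
    fix a b assume "p dvd a * b"
    then obtain c where c: "a * b = p * c" by blast
    have "([a] \<cdot> \<one>) \<otimes> ([b] \<cdot> \<one>) = [(b * a)] \<cdot> \<one>"
      by (simp add: add_pow_rdistr add.nat_pow_pow mult.commute)
    also have "\<dots> = [c] \<cdot> ([p] \<cdot> \<one>)"
      unfolding mult.commute[of b a] c by (simp add: add.nat_pow_pow)
    also have "\<dots> = \<zero>" using p(2) by simp
    finally have "[a] \<cdot> \<one> = \<zero> \<or> [b] \<cdot> \<one> = \<zero>"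
      by (simp add: integral_iff)
    then show "p dvd a \<or> p dvd b" using dvd by blast
  qed
  then show thesis using that p(2) dvd by blast
qed

section \<open>Formal derivatives, and polynomials whose derivative vanishes\<close>

fun (in ring) formal_deriv :: "'a list \<Rightarrow> 'a list" where
  "formal_deriv [] = []"
| "formal_deriv (a # p) = (if p = [] then [] else [length p] \<cdot> a # formal_deriv p)"

lemma (in ring) length_formal_deriv [simp]: "length (formal_deriv p) = length p - 1"
  by (induct p) auto

lemma (in cring) formal_deriv_in_subring:
  assumes "subring H R" "set p \<subseteq> H"
  shows "set (formal_deriv p) \<subseteq> H"
  using assms(2) by (induct p) (auto simp: add_pow_in_subring[OF assms(1)])

lemma (in cring) formal_deriv_in_carrier:
  "set p \<subseteq> carrier R \<Longrightarrow> set (formal_deriv p) \<subseteq> carrier R"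
  by (rule formal_deriv_in_subring[OF carrier_is_subring])

context cring
begin

lemma eval_formal_deriv_closed [simp]:
  "set p \<subseteq> carrier R \<Longrightarrow> x \<in> carrier R \<Longrightarrow> eval (formal_deriv p) x \<in> carrier R"
  by (simp add: eval_in_carrier formal_deriv_in_carrier)

text \<open>Lists start with the leading coefficient, so the head belongs to the power
  \<open>length p\<close>. With \<open>p = []\<close> the added summand is a zero multiple, so the
  truncated exponent \<open>length p - 1\<close> is harmless and the case distinction of the
  definition disappears.\<close>

lemma eval_formal_deriv_Cons:
  assumes "a \<in> carrier R" "x \<in> carrier R" "set p \<subseteq> carrier R"
  shows "eval (formal_deriv (a # p)) x
       = [length p] \<cdot> (a \<otimes> x [^] (length p - 1)) \<oplus> eval (formal_deriv p) x"
  using assms by (auto simp: add_pow_ldistr)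

text \<open>A formal derivative may begin with zeros, because the characteristic can kill a
  coefficient. The rules of differentiation are therefore stated for values at a point.\<close>

lemma eval_formal_deriv_normalize:
  assumes "set p \<subseteq> carrier R" "x \<in> carrier R"
  shows "eval (formal_deriv (normalize p)) x = eval (formal_deriv p) x"
  using assms(1)
proof (induct p)
  case (Cons a p)
  then show ?case
    using assms(2) by (cases "a = \<zero>") (simp_all add: eval_formal_deriv_Cons del: formal_deriv.simps)
qed simp

lemma eval_formal_deriv_replicate:
  assumes "set p \<subseteq> carrier R" "x \<in> carrier R"
  shows "eval (formal_deriv (replicate n \<zero> @ p)) x = eval (formal_deriv p) x"
proof (induct n)
  case (Suc n)
  have "set (replicate n \<zero> @ p) \<subseteq> carrier R"
    using assms(1) by (auto simp: set_replicate_conv_if)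
  with Suc show ?case
    using assms(2) by (simp add: eval_formal_deriv_Cons assms del: formal_deriv.simps)
qed simp

lemma map2_add_closed:
  "set p \<subseteq> carrier R \<Longrightarrow> set q \<subseteq> carrier R \<Longrightarrow> set (map2 (\<oplus>) p q) \<subseteq> carrier R"
  by (auto elim!: in_set_zipE)

lemma eval_formal_deriv_map2:
  assumes "length p = length q" "set p \<subseteq> carrier R" "set q \<subseteq> carrier R" "x \<in> carrier R"
  shows "eval (formal_deriv (map2 (\<oplus>) p q)) x = eval (formal_deriv p) x \<oplus> eval (formal_deriv q) x"
  using assms(1-3)
proof (induct p q rule: list_induct2)
  case (Cons a p b q)
  have "set (map2 (\<oplus>) p q) \<subseteq> carrier R"
    using Cons(3,4) by (intro map2_add_closed) auto
  with Cons show ?case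
    using assms(4)
    by (simp add: eval_formal_deriv_Cons l_distr add.nat_pow_distrib add.m_ac
          del: formal_deriv.simps)
qed simp

lemma eval_formal_deriv_poly_add:
  assumes "set p \<subseteq> carrier R" "set q \<subseteq> carrier R" "x \<in> carrier R"
  shows "eval (formal_deriv (poly_add p q)) x = eval (formal_deriv p) x \<oplus> eval (formal_deriv q) x"
proof -
  have *: "eval (formal_deriv (poly_add p q)) x = eval (formal_deriv p) x \<oplus> eval (formal_deriv q) x"
    if "length q \<le> length p" and pq: "set p \<subseteq> carrier R" "set q \<subseteq> carrier R" for p q
  proof -
    let ?q = "replicate (length p - length q) \<zero> @ q"
    have q: "set ?q \<subseteq> carrier R" "length p = length ?q"
      using that by auto
    then have "set (map2 (\<oplus>) p ?q) \<subseteq> carrier R"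
      using pq(1) by (intro map2_add_closed)
    then show ?thesis
      using that(1) eval_formal_deriv_map2[OF q(2) pq(1) q(1) assms(3)]
      by (simp add: eval_formal_deriv_normalize eval_formal_deriv_replicate pq assms(3))
  qed
  show ?thesis
  proof (cases "length q \<le> length p")
    case False
    then show ?thesis
      using *[of p q] assms poly_add_comm[OF assms(1,2)] by (simp add: a_comm del: poly_add.simps)
  qed (use * assms in blast)
qed

lemma eval_formal_deriv_smult:
  assumes "a \<in> carrier R" "set p \<subseteq> carrier R" "x \<in> carrier R"
  shows "eval (formal_deriv (map ((\<otimes>) a) p)) x = a \<otimes> eval (formal_deriv p) x"
  using assms(2)
proof (induct p)
  case (Cons b p)
  have "set (map ((\<otimes>) a) p) \<subseteq> carrier R"
    using Cons(2) assms by auto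
  with Cons show ?case
    using assms
    by (simp add: eval_formal_deriv_Cons r_distr add_pow_rdistr m_assoc del: formal_deriv.simps)
qed (use assms in simp)

text \<open>Appending \<open>b\<close> turns \<open>p\<close> into \<open>X p + b\<close>, so this
  is the product rule for the factor \<open>X\<close>.\<close>

lemma eval_formal_deriv_snoc:
  assumes "set p \<subseteq> carrier R" "b \<in> carrier R" "x \<in> carrier R"
  shows "eval (formal_deriv (p @ [b])) x = eval (formal_deriv p) x \<otimes> x \<oplus> eval p x"
  using assms(1)
proof (induct p)
  case (Cons a p)
  have p: "set (p @ [b]) \<subseteq> carrier R" "set p \<subseteq> carrier R" "a \<in> carrier R"
    using Cons(2) assms by auto
  have "[length p] \<cdot> (a \<otimes> x [^] (length p - 1)) \<otimes> x = [length p] \<cdot> (a \<otimes> x [^] length p)"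
    using p assms by (cases p) (auto simp: add_pow_ldistr m_assoc l_distr)
  with p Cons(1)[OF p(2)] show ?case
    using assms
    by (simp add: eval_formal_deriv_Cons l_distr eval_in_carrier add.m_ac
          del: formal_deriv.simps)
qed (use assms in simp)

end

text \<open>Product rule at the zero of the linear factor: in \<open>q + (X - x) q'\<close> the
  second summand vanishes at \<open>x\<close>. The product is split as \<open>X q - x q\<close>,
  which reduces it to the rules for appending an entry and for scalar multiples.\<close>

lemma (in domain) eval_formal_deriv_linear_factor:
  assumes "set q \<subseteq> carrier R" "x \<in> carrier R"
  shows "eval (formal_deriv (poly_mult [\<one>, \<ominus> x] q)) x = eval q x"
proof -
  have q: "set (map ((\<otimes>) (\<ominus> x)) q) \<subseteq> carrier R" "map ((\<otimes>) \<one>) q = q" "set (q @ [\<zero>]) \<subseteq> carrier R"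
    using assms by (auto intro!: map_idI)
  have "poly_mult [\<one>, \<ominus> x] q = poly_add (q @ [\<zero>]) (poly_mult [\<ominus> x] q)"
    using q(2) by simp
  also have "poly_mult [\<ominus> x] q = normalize (map ((\<otimes>) (\<ominus> x)) q)"
    using assms by (intro poly_mult_const') auto
  finally have "eval (formal_deriv (poly_mult [\<one>, \<ominus> x] q)) x
      = eval (formal_deriv (q @ [\<zero>])) x \<oplus> eval (formal_deriv (map ((\<otimes>) (\<ominus> x)) q)) x"
    using q assms
    by (simp add: eval_formal_deriv_poly_add normalize_in_carrier eval_formal_deriv_normalize
          del: poly_add.simps)
  also have "\<dots> = eval (formal_deriv q) x \<otimes> x \<oplus> eval q x \<oplus> (\<ominus> x) \<otimes> eval (formal_deriv q) x"
    using assms by (simp add: eval_formal_deriv_snoc eval_formal_deriv_smult)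
  also have "\<dots> = eval q x"
    using assms by (simp add: l_minus m_comm eval_in_carrier a_ac r_neg1 r_neg2 r_neg)
  finally show ?thesis .
qed

text \<open>This is the polynomial \<open>g\<close> with \<open>f = g(X^d)\<close>, provided that
  only exponents divisible by \<open>d\<close> occur in \<open>f\<close>; the length of the tail is
  the exponent of the head.\<close>

fun compress :: "nat \<Rightarrow> 'a list \<Rightarrow> 'a list" where
  "compress d [] = []"
| "compress d (a # p) = (if d dvd length p then a # compress d p else compress d p)"

text \<open>The right-hand side is the quotient rounded up, the number of multiples of
  \<open>d\<close> among the exponents \<open>0, ..., length p - 1\<close>.\<close>

lemma length_compress:
  assumes "d > 0"
  shows "length (compress d p) = (length p + (d - 1)) div d"
proof (induct p)
  case Nil
  then show ?case using assms by simp
next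
  case (Cons a p)
  obtain e where d: "d = Suc e" using assms by (cases d) auto
  show ?case
  proof (cases "d dvd length p")
    case True
    then obtain m where "length p = d * m" by blast
    moreover from this have "(length p + e) div d = m" "Suc (length p + e) div d = Suc m"
      unfolding d by (auto intro!: div_nat_eqI)
    ultimately show ?thesis using Cons True d by simp
  next
    case False
    define m where "m = length p div d"
    define r where "r = length p mod d"
    have p: "length p = d * m + r" and r: "r > 0" "r < d"
      using False assms unfolding m_def r_def by (auto simp: mod_greater_zero_iff_not_dvd)
    have "(length p + e) div d = Suc m" "Suc (length p + e) div d = Suc m"
      using r unfolding p d by (auto intro!: div_nat_eqI)
    then show ?thesis using Cons False d by simp
  qed
qed

lemma set_compress_subset: "set (compress d p) \<subseteq> set p"
  by (induct p) auto

lemma (in cring) eval_compress: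
  assumes "d > 0" "set p \<subseteq> carrier R" "x \<in> carrier R"
    and "\<And>i. i < length p \<Longrightarrow> \<not> d dvd i \<Longrightarrow> coeff p i = \<zero>"
  shows "eval (compress d p) (x [^] d) = eval p x"
  using assms(2,4)
proof (induct p)
  case (Cons a p)
  have coeff: "coeff p i = \<zero>" if "i < length p" "\<not> d dvd i" for i
    using Cons(3)[of i] that by simp
  have IH: "eval (compress d p) (x [^] d) = eval p x"
    using Cons(1,2) coeff by simp
  show ?case
  proof (cases "d dvd length p")
    case True
    then obtain m where m: "length p = d * m" by blast
    have "length (compress d p) = m"
      unfolding length_compress[OF assms(1)] m using assms(1) by (intro div_nat_eqI) auto
    then show ?thesis
      using True IH m assms(3) by (simp add: nat_pow_pow)
  next
    case False
    then have "a = \<zero>" using Cons(3)[of "length p"] by simp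
    then show ?thesis
      using False IH Cons(2) assms(3) by (simp add: eval_in_carrier)
  qed
qed simp

lemma (in ring) normalize_eq_Nil_imp_zero:
  "normalize p = [] \<Longrightarrow> set p \<subseteq> {\<zero>}"
  by (induct p) (auto split: if_splits)

lemma (in cring) coeff_formal_deriv:
  assumes "set p \<subseteq> carrier R"
  shows "coeff (formal_deriv p) i = [Suc i] \<cdot> coeff p (Suc i)"
  using assms
proof (induct p)
  case (Cons a p)
  then show ?case by (cases p) auto
qed simp


lemma (in domain) nat_pow_eq_zero:
  fixes n :: nat
  assumes "x \<in> carrier R" "x [^] n = \<zero>"
  shows "x = \<zero>"
  using assms(2) by (induct n) (auto simp: assms(1) integral_iff)

text \<open>
  If \<open>f' = 0\<close>, then \<open>f = g(X\<^sup>p)\<close>, and perfectness lets us take \<open>p\<close>-th roots of the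
  coefficients: \<open>f(x) = h(x)\<^sup>p\<close> with \<open>deg h < deg f\<close>.
\<close>

lemma (in domain) perfect_deriv_zero_descent:
  assumes K: "subfield K R" and "perfect R K"
    and f: "f \<in> carrier (K[X])" "degree f > 0"
    and x: "x \<in> carrier R" "eval f x = \<zero>"
    and deriv: "set (formal_deriv f) \<subseteq> {\<zero>}"
  shows "\<exists>h \<in> carrier (K[X]). h \<noteq> [] \<and> eval h x = \<zero> \<and> degree h < degree f"
proof -
  have KR: "K \<subseteq> carrier R" using subfieldE(3)[OF K] .
  have fK: "set f \<subseteq> K" and lc: "lead_coeff f \<noteq> \<zero>" and "f \<noteq> []"
    using f unfolding sym[OF univ_poly_carrier] polynomial_def by auto
  have fR: "set f \<subseteq> carrier R" using fK KR by blast
  have deriv0: "[Suc i] \<cdot> coeff f (Suc i) = \<zero>" for i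
  proof -
    have "coeff (formal_deriv f) i \<in> set (formal_deriv f) \<union> {\<zero>}"
      unfolding coeff_img(3)[symmetric] by blast
    then show ?thesis
      using deriv unfolding coeff_formal_deriv[OF fR] by blast
  qed
  have dvd_or: "([i] \<cdot> \<one>) = \<zero> \<or> coeff f i = \<zero>" if "i > 0" for i :: nat
  proof -
    have "([i] \<cdot> \<one>) \<otimes> coeff f i = \<zero>"
      using deriv0[of "i - 1"] that unfolding add_pow_one_mult[OF coeff_in_carrier[OF fR]]
      by (simp only: Suc_diff_1)
    then show ?thesis
      using integral coeff_in_carrier[OF fR] add.nat_pow_closed[OF one_closed] by blast
  qed
  \<comment> \<open>The leading coefficient is nonzero, so a vanishing derivative forces the degree
    to be zero in the ring. Hence the characteristic is positive.\<close>
  have "[degree f] \<cdot> \<one> = \<zero>"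
    using dvd_or[OF f(2)] lc lead_coeff_simp[OF \<open>f \<noteq> []\<close>] by simp
  then obtain p :: nat where p: "Factorial_Ring.prime p" "[p] \<cdot> \<one> = \<zero>"
    and p_dvd: "\<And>m :: nat. [m] \<cdot> \<one> = \<zero> \<Longrightarrow> p dvd m"
    using characteristic_cases f(2) by blast
  have p0: "p > 0" and p1: "p > 1"
    using prime_gt_0_nat[OF p(1)] prime_gt_1_nat[OF p(1)] by auto
  have "\<forall>a \<in> K. \<exists>b \<in> K. b [^] p = a"
    using assms(2) p unfolding perfect_def by blast
  then obtain r where r: "\<And>a. a \<in> K \<Longrightarrow> r a \<in> K" "\<And>a. a \<in> K \<Longrightarrow> r a [^] p = a"
    by metis
  interpret Frob: ring_hom_ring R R "\<lambda>x. x [^] p"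
    using ring_hom_ringI2[OF ring_axioms ring_axioms frobenius_hom[OF p]] .
  have coeff0: "coeff f i = \<zero>" if "\<not> p dvd i" for i
    using dvd_or[of i] p_dvd[of i] that by (cases "i = 0") auto
  define h where "h = map r (compress p f)"
  have cK: "set (compress p f) \<subseteq> K"
    using set_compress_subset[of p f] fK by blast
  then have hK: "set h \<subseteq> K"
    unfolding h_def using r(1) by auto
  have "map (\<lambda>x. x [^] p) h = compress p f"
    unfolding h_def using cK r(2) by (auto intro!: map_idI)
  \<comment> \<open>Frobenius, applied to the coefficients of \<open>h\<close>, returns
    \<open>compress p f\<close>. So the \<open>p\<close>-th power of \<open>h(x)\<close> is
    \<open>f(x) = 0\<close>, and \<open>h(x)\<close> vanishes too.\<close>
  then have "eval h x [^] p = eval (compress p f) (x [^] p)"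
    using Frob.eval_hom'[OF x(1), of h] hK KR by auto
  also have "\<dots> = eval f x"
    using eval_compress[OF p0 fR x(1)] coeff0 by blast
  finally have hx: "eval h x = \<zero>"
    using x(2) nat_pow_eq_zero[OF eval_in_carrier[OF subset_trans[OF hK KR] x(1)]] by simp
  obtain a f' where f': "f = a # f'" using \<open>f \<noteq> []\<close> by (cases f) auto
  \<comment> \<open>The leading exponent is divisible by \<open>p\<close>, so the leading
    coefficient survives in \<open>compress p f\<close>, and its nonzero \<open>p\<close>-th root is
    the leading coefficient of \<open>h\<close>.\<close>
  have "p dvd length f'"
    using coeff0[of "length f'"] lc f' by auto
  then have h': "h = r a # map r (compress p f')"
    unfolding h_def f' by simp
  have "a \<in> K" "a \<noteq> \<zero>" using fK lc f' by auto
  then have "r a \<noteq> \<zero>" using r(2)[of a] p0 by (metis nat_pow_zero not_gr_zero)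
  then have hX: "h \<in> carrier (K[X])"
    unfolding sym[OF univ_poly_carrier] polynomial_def using hK h' by auto
  have "length (compress p f') = (length f' + (p - 1)) div p"
    using length_compress[OF p0] .
  also have "\<dots> = length f' div p"
    using \<open>p dvd length f'\<close> p0 by (auto elim!: dvdE intro!: div_nat_eqI)
  also have "\<dots> < length f'"
    using p1 f(2) f' by simp
  finally have "degree h < degree f"
    unfolding h' f' by simp
  then show ?thesis using hX hx h' by blast
qed

section \<open>Minimal polynomials and simplicity of roots\<close>

lemma (in domain) Irr_degree_le:
  assumes "subfield K R" "x \<in> carrier R" "p \<in> carrier (K[X])" "p \<noteq> []" "eval p x = \<zero>"
  shows "degree (Irr K x) \<le> degree p"
proof -
  have alg: "(algebraic over K) x" using algebraicI assms(3-5) .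
  show ?thesis
    using pdivides_imp_degree_le[OF subfieldE(1)[OF assms(1)] IrrE(1)[OF assms(1,2) alg] assms(3,4)]
      Irr_minimal[OF assms(1,2) alg assms(3,5)] by blast
qed

text \<open>\<open>Irr K x\<close> divides the irreducible \<open>f\<close> and is not a unit, so
  the two are associated.\<close>

lemma (in domain) Irr_degree_eq:
  assumes K: "subfield K R" and x: "x \<in> carrier R"
    and f: "f \<in> carrier (K[X])" "pirreducible K f" "eval f x = \<zero>"
  shows "degree (Irr K x) = degree f"
proof -
  have fn: "f \<noteq> []" using pirreducibleE(1)[OF subfieldE(1)[OF K] f(1,2)] .
  have alg: "(algebraic over K) x" using algebraicI[OF f(1) fn f(3)] .
  note Irr = IrrE[OF K x alg]
  have "Irr K x divides\<^bsub>K[X]\<^esub> f"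
    using Irr_minimal[OF K x alg f(1,3)] pdivides_iff_shell[OF K Irr(1) f(1)] by blast
  then have "Irr K x \<sim>\<^bsub>K[X]\<^esub> f"
    using divides_pirreducible_condition[OF f(2) Irr(1)]
      pirreducibleE(2)[OF subfieldE(1)[OF K] Irr(1,2)] by blast
  then show ?thesis
    using associated_polynomials_imp_same_length[OF subfieldE(1)[OF K] Irr(1) f(1)] by simp
qed

text \<open>A multiple root is also a root of the derivative, whose degree is smaller than that of
  the minimal polynomial of \<open>x\<close>. So the derivative must be zero, and then the descent
  yields another nonzero polynomial of too small degree vanishing at \<open>x\<close>.\<close>

lemma (in domain) alg_mult_irreducible_perfect:
  assumes K: "subfield K R" and "perfect R K"
    and f: "f \<in> carrier (K[X])" "pirreducible K f"
  shows "alg_mult f x \<le> 1"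
proof (rule ccontr)
  assume mult: "\<not> alg_mult f x \<le> 1"
  have fR: "f \<in> carrier (poly_ring R)"
    using carrier_polynomial_shell[OF subfieldE(1)[OF K] f(1)] .
  have fset: "set f \<subseteq> carrier R"
    using fR unfolding sym[OF univ_poly_carrier] polynomial_def by auto
  have "is_root f x"
    using mult alg_mult_gt_zero_iff_is_root[OF fR, of x] by simp
  then have x: "x \<in> carrier R" "eval f x = \<zero>"
    by (auto simp: is_root_def)
  interpret UP: domain "poly_ring R"
    using univ_poly_is_domain[OF carrier_is_subring] .
  have X: "[\<one>, \<ominus> x] \<in> carrier (poly_ring R)"
    using x unfolding sym[OF univ_poly_carrier] polynomial_def by simp
  have "([\<one>, \<ominus> x] [^]\<^bsub>poly_ring R\<^esub> (2 :: nat)) pdivides f"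
    using le_alg_mult_imp_pdivides[OF x(1) fR, of 2] mult by simp
  then obtain g where g: "g \<in> carrier (poly_ring R)"
    "f = [\<one>, \<ominus> x] \<otimes>\<^bsub>poly_ring R\<^esub> ([\<one>, \<ominus> x] \<otimes>\<^bsub>poly_ring R\<^esub> g)"
    unfolding pdivides_def factor_def using X
    by (auto simp: numeral_2_eq_2 UP.m_assoc)
  have gset: "set g \<subseteq> carrier R" "set [\<one>, \<ominus> x] \<subseteq> carrier R"
    using g(1) X unfolding sym[OF univ_poly_carrier] polynomial_def by auto
  have "eval (formal_deriv f) x = eval (poly_mult [\<one>, \<ominus> x] g) x"
    unfolding g(2) univ_poly_mult
    using eval_formal_deriv_linear_factor[OF poly_mult_in_carrier[OF gset(2,1)] x(1)] .
  also have "\<dots> = eval [\<one>, \<ominus> x] x \<otimes> eval g x"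
    using eval_poly_mult[OF gset(2,1) x(1)] .
  also have "\<dots> = \<zero>"
    using x(1) gset by (simp add: eval_in_carrier r_neg)
  finally have dx: "eval (formal_deriv f) x = \<zero>" .
  let ?d = "normalize (formal_deriv f)"
  have dset: "set (formal_deriv f) \<subseteq> K"
    using formal_deriv_in_subring[OF subfieldE(1)[OF K]] f(1)
    unfolding sym[OF univ_poly_carrier] polynomial_def by auto
  have deg: "degree (Irr K x) = degree f"
    using Irr_degree_eq[OF K x(1) f x(2)] .
  have f1: "degree f \<ge> 1"
    using pirreducible_degree[OF K f] .
  have d: "?d \<in> carrier (K[X])" "eval ?d x = \<zero>" "degree ?d < degree f"
    using normalize_gives_polynomial[OF dset] univ_poly_carrier dx
      eval_normalize[OF formal_deriv_in_carrier[OF fset] x(1)]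
      normalize_length_le[of "formal_deriv f"] f1 by auto
  show False
  proof (cases "?d = []")
    case True
    then have "set (formal_deriv f) \<subseteq> {\<zero>}"
      by (rule normalize_eq_Nil_imp_zero)
    then obtain h where "h \<in> carrier (K[X])" "h \<noteq> []" "eval h x = \<zero>" "degree h < degree f"
      using perfect_deriv_zero_descent[OF K assms(2) f(1) _ x] f1 by (meson less_le_trans zero_less_one)
    then show False
      using Irr_degree_le[OF K x(1)] deg by fastforce
  next
    case False
    then show False
      using Irr_degree_le[OF K x(1) d(1) False d(2)] deg d(3) by linarith
  qed
qed

text \<open>All multiplicities are at most one, so the multiset of roots is a set; its size is the
  degree because \<open>f\<close> splits over the algebraic closure.\<close>

lemma (in algebraic_closure) card_roots_irreducible_perfect:
  assumes "perfect L K" "f \<in> carrier (K[X])" "pirreducible K f"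
  shows "card (root_set L f) = degree f"
proof -
  have f: "f \<in> carrier (poly_ring L)"
    using carrier_polynomial_shell[OF subfieldE(1)[OF subfield_axioms] assms(2)] .
  have "count (roots f) x \<le> 1" for x
    using alg_mult_irreducible_perfect[OF subfield_axioms assms] alg_mult_eq_count_roots[OF f] by metis
  then have "\<forall>x. count (roots f) x = (if x \<in># roots f then 1 else 0)"
    by (metis One_nat_def count_eq_zero_iff le_Suc_eq le_zero_eq)
  then have "roots f = mset_set (set_mset (roots f))"
    by (intro multiset_eqI) (simp add: count_mset_set')
  then have "size (roots f) = card (set_mset (roots f))"
    by (metis size_mset_set)
  moreover have "set_mset (roots f) = root_set L f"
    unfolding root_set_def using roots_mem_iff_is_root[OF f] by auto
  moreover have "size (roots f) = degree f"
    using roots_over_subfield[OF assms(2)] unfolding splitted_def .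
  ultimately show ?thesis by simp
qed

section \<open>Intermediate fields and their embeddings\<close>

lemma (in field) card_le_degree:
  assumes "p \<in> carrier (poly_ring R)" "p \<noteq> []" "S \<subseteq> carrier R" "\<And>x. x \<in> S \<Longrightarrow> eval p x = \<zero>"
  shows "card S \<le> degree p"
proof -
  have "S \<subseteq> set_mset (roots p)"
    using assms roots_mem_iff_is_root[OF assms(1)] by (auto simp: is_root_def)
  then have "card S \<le> card (set_mset (roots p))"
    by (intro card_mono) auto
  also have "\<dots> \<le> size (roots p)"
    unfolding size_multiset_overloaded_eq card_eq_sum by (intro sum_mono) (simp add: Suc_le_eq)
  also have "\<dots> \<le> degree p"
    using size_roots_le_degree[OF assms(1)] .
  finally show ?thesis .
qed

text \<open>A monic linear minimal polynomial is \<open>X - x\<close>, whose coefficients lie in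
  \<open>E\<close> exactly when \<open>x\<close> does.\<close>

lemma (in domain) Irr_degree_one_iff:
  assumes "subfield E R" "x \<in> carrier R" "(algebraic over E) x"
  shows "degree (Irr E x) = 1 \<longleftrightarrow> x \<in> E"
proof
  note Irr = IrrE[OF assms]
  assume "degree (Irr E x) = 1"
  then obtain a b where ab: "a \<in> E" "b \<in> E" "Irr E x = [a, b]"
    using degree_oneE[OF Irr(1)] by metis
  have "b \<in> carrier R" using ab(2) subfieldE(3)[OF assms(1)] by blast
  then have "x \<oplus> b = \<zero>"
    using Irr(3,4) ab assms(2) by simp
  then have "x = \<ominus> b"
    using minus_equality[of x b] \<open>b \<in> carrier R\<close> assms(2) by simp
  then show "x \<in> E"
    using subringE(5)[OF subfieldE(1)[OF assms(1)] ab(2)] by simp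
next
  assume x: "x \<in> E"
  have "[\<one>, \<ominus> x] \<in> carrier (E[X])"
    using x subringE(3,5)[OF subfieldE(1)[OF assms(1)]]
    unfolding sym[OF univ_poly_carrier] polynomial_def by auto
  moreover have "eval [\<one>, \<ominus> x] x = \<zero>"
    using assms(2) by (simp add: r_neg)
  ultimately have "degree (Irr E x) \<le> 1"
    using Irr_degree_le[OF assms(1,2)] by fastforce
  then show "degree (Irr E x) = 1"
    using pirreducible_degree[OF assms(1) IrrE(1,2)[OF assms]] by simp
qed

text \<open>Separability is recorded as the equality of the number of roots with the degree, the
  form in which perfectness of \<open>K\<close> enters the later counting arguments.\<close>

locale separable_irreducible = algebraic_closure L K for L (structure) and K +
  fixes f
  assumes f_carrier: "f \<in> carrier (K[X])"
    and f_irreducible: "pirreducible K f"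
    and card_roots: "card (root_set L f) = degree f"
begin

abbreviation Rt where "Rt \<equiv> root_set L f"
abbreviation F where "F B \<equiv> adjoin L K B"

lemma f_not_Nil: "f \<noteq> []"
  using pirreducibleE(1)[OF subfieldE(1)[OF subfield_axioms] f_carrier f_irreducible] .

lemma degree_f_pos: "degree f \<ge> 1"
  using pirreducible_degree[OF subfield_axioms f_carrier f_irreducible] .

lemma Rt_iff: "x \<in> Rt \<longleftrightarrow> x \<in> carrier L \<and> eval f x = \<zero>"
  using f_not_Nil by (auto simp: root_set_def is_root_def)

lemma Rt_carrier: "Rt \<subseteq> carrier L"
  by (auto simp: Rt_iff)

lemma finite_Rt: "finite Rt"
  using card_roots degree_f_pos by (metis One_nat_def card.infinite not_one_le_zero)

lemma K_carrier: "K \<subseteq> carrier L"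
  using subfieldE(3)[OF subfield_axioms] .

lemma algebraic_over:
  assumes "K \<subseteq> E" "x \<in> carrier L"
  shows "(algebraic over E) x"
  using algebraic_mono[OF assms(1)] algebraic_extension[OF assms(2)] by blast

lemma F_subfield: "B \<subseteq> carrier L \<Longrightarrow> subfield (F B) L"
  unfolding adjoin_def using K_carrier by (intro generate_field_is_subfield) auto

lemma F_incl: "B \<subseteq> F B" and K_le_F: "K \<subseteq> F B"
  unfolding adjoin_def by (auto intro: generate_field.incl)

lemma F_minimal:
  assumes "B \<subseteq> carrier L" "subfield E L" "K \<subseteq> E" "B \<subseteq> E"
  shows "F B \<subseteq> E"
  unfolding adjoin_def using assms K_carrier by (intro generate_field_min_subfield1) auto

lemma F_mono: "A \<subseteq> B \<Longrightarrow> B \<subseteq> carrier L \<Longrightarrow> F A \<subseteq> F B"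
  unfolding adjoin_def using K_carrier by (intro mono_generate_field) auto

lemma F_carrier: "B \<subseteq> carrier L \<Longrightarrow> F B \<subseteq> carrier L"
  using subfieldE(3)[OF F_subfield] .

lemma F_empty: "F {} = K"
  using F_minimal[OF _ subfield_axioms] K_le_F by blast

text \<open>Both sides are the least subfield containing \<open>F B\<close> and \<open>x\<close>;
  the simple extension is a field since \<open>x\<close> is algebraic. This allows roots to be
  adjoined one at a time.\<close>

lemma F_insert:
  assumes "B \<subseteq> carrier L" "x \<in> carrier L"
  shows "F (insert x B) = simple_extension (F B) x"
proof
  have sub: "subfield (simple_extension (F B) x) L"
    using simple_extension_is_subfield[OF F_subfield[OF assms(1)] assms(2)]
      algebraic_over[OF K_le_F assms(2)] by blast
  have "F B \<subseteq> simple_extension (F B) x"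
    using simple_extension_incl[OF F_carrier[OF assms(1)] assms(2)] .
  moreover have "x \<in> simple_extension (F B) x"
    using simple_extension_mem[OF subfieldE(1)[OF F_subfield[OF assms(1)]] assms(2)] .
  ultimately show "F (insert x B) \<subseteq> simple_extension (F B) x"
    using assms F_incl[of B] K_le_F[of B] by (intro F_minimal[OF _ sub]) auto
  show "simple_extension (F B) x \<subseteq> F (insert x B)"
    using assms F_incl[of "insert x B"] F_mono[of B "insert x B"]
    by (intro simple_extension_subring_incl[OF subfieldE(1)[OF F_subfield]]) auto
qed

lemma F_dim:
  assumes "finite B" "B \<subseteq> carrier L"
  shows "finite_dimension K (F B)"
  using assms
proof (induct B)
  case empty
  then show ?case
    using finite_dimensionI[OF dimension_one[OF subfield_axioms]] F_empty by simp
next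
  case (insert x B)
  then show ?case
    using telescopic_base_dim(1)[OF subfield_axioms F_subfield[of B], of "simple_extension (F B) x"]
      finite_dimension_simple_extension[OF F_subfield[of B], of x] algebraic_over[OF K_le_F, of x]
      F_insert[of B x] by auto
qed

text \<open>Tower law, with the degree of a simple extension read off from the minimal polynomial of
  its generator.\<close>

lemma dim_F_insert:
  assumes "finite B" "B \<subseteq> carrier L" "x \<in> carrier L"
  shows "dim K (F (insert x B)) = dim K (F B) * degree (Irr (F B) x)"
  using telescopic_base_dim(2)[OF subfield_axioms F_subfield[OF assms(2)] F_dim[OF assms(1,2)],
      of "simple_extension (F B) x"]
    finite_dimension_simple_extension[OF F_subfield[OF assms(2)] assms(3)]
    simple_extension_dim[OF F_subfield[OF assms(2)] assms(3)]
    algebraic_over[OF K_le_F assms(3)] F_insert[OF assms(2,3)]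
  by (simp add: over_def)

lemma dim_K: "dim K K = 1"
  using dimI[OF subfield_axioms dimension_one[OF subfield_axioms]] by (simp add: over_def)

lemma Irr_over_pos:
  assumes "subfield E L" "K \<subseteq> E" "x \<in> carrier L"
  shows "degree (Irr E x) \<ge> 1"
  using pirreducible_degree[OF assms(1) IrrE(1,2)[OF assms(1,3) algebraic_over[OF assms(2,3)]]] .

lemma degree_Irr_K: "x \<in> Rt \<Longrightarrow> degree (Irr K x) = degree f"
  using Irr_degree_eq[OF subfield_axioms _ f_carrier f_irreducible] by (simp add: Rt_iff)

text \<open>If \<open>y\<close> in \<open>E\<close> were a root of \<open>Irr E x\<close>, the
  minimal polynomials of \<open>x\<close> and \<open>y\<close> over \<open>E\<close> would have the
  same degree, which is one for \<open>y\<close>; this would put \<open>x\<close> into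
  \<open>E\<close>. Since \<open>f\<close> vanishes at its roots in \<open>E\<close>, the cofactor
  has to vanish there.\<close>

lemma Irr_cofactor:
  assumes E: "subfield E L" "K \<subseteq> E" and x: "x \<in> Rt"
  obtains q where "q \<in> carrier (E[X])" "q \<noteq> []" "f = Irr E x \<otimes>\<^bsub>E[X]\<^esub> q"
    "degree f = degree (Irr E x) + degree q"
    "\<And>y. x \<notin> E \<Longrightarrow> y \<in> Rt \<inter> E \<Longrightarrow> eval q y = \<zero>"
proof -
  have xL: "x \<in> carrier L" "eval f x = \<zero>" using x by (auto simp: Rt_iff)
  note alg = algebraic_over[OF E(2) xL(1)]
  note Irr = IrrE[OF E(1) xL(1) alg]
  have f: "f \<in> carrier (E[X])"
    using f_carrier E(2) unfolding sym[OF univ_poly_carrier] polynomial_def by auto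
  obtain q where q: "q \<in> carrier (E[X])" "f = Irr E x \<otimes>\<^bsub>E[X]\<^esub> q"
    using Irr_minimal[OF E(1) xL(1) alg f xL(2)] pdivides_iff_shell[OF E(1) Irr(1) f]
    unfolding factor_def by blast
  have ne: "q \<noteq> []" "Irr E x \<noteq> []"
    using f_not_Nil q(2) poly_mult_zero(2)[of "Irr E x"] Irr(1) subfieldE(3)[OF E(1)]
    unfolding univ_poly_mult sym[OF univ_poly_carrier] polynomial_def by auto
  have deg: "degree f = degree (Irr E x) + degree q"
    using poly_mult_degree_eq[OF subfieldE(1)[OF E(1)], of "Irr E x" q] Irr(1) q ne
    unfolding univ_poly_mult univ_poly_carrier by simp
  have "eval q y = \<zero>" if xE: "x \<notin> E" and y: "y \<in> Rt \<inter> E" for y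
  proof -
    have yL: "y \<in> carrier L" "eval f y = \<zero>" using y by (auto simp: Rt_iff)
    have "eval (Irr E x) y \<noteq> \<zero>"
    proof
      assume "eval (Irr E x) y = \<zero>"
      then have "degree (Irr E y) = degree (Irr E x)"
        using Irr_degree_eq[OF E(1) yL(1) Irr(1,2)] by simp
      then show False
        using Irr_degree_one_iff[OF E(1) xL(1) alg] y xE
          Irr_degree_one_iff[OF E(1) yL(1) algebraic_over[OF E(2) yL(1)]] by auto
    qed
    moreover have "eval (Irr E x) y \<otimes> eval q y = \<zero>"
      using ring_hom_memE(2)[OF eval_is_hom[OF subfieldE(1)[OF E(1)] yL(1)] Irr(1) q(1)] yL(2) q(2)
      by simp
    moreover have "set (Irr E x) \<subseteq> carrier L" "set q \<subseteq> carrier L"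
      using Irr(1) q(1) subfieldE(3)[OF E(1)] unfolding sym[OF univ_poly_carrier] polynomial_def by auto
    ultimately show ?thesis
      using yL(1) eval_in_carrier integral by blast
  qed
  then show thesis using that q ne(1) deg by blast
qed

lemma Irr_degree_bound:
  assumes E: "subfield E L" "K \<subseteq> E" and x: "x \<in> Rt" "x \<notin> E"
  shows "card (Rt \<inter> E) + degree (Irr E x) \<le> degree f"
proof -
  obtain q where q: "q \<in> carrier (E[X])" "q \<noteq> []" "degree f = degree (Irr E x) + degree q"
    "\<And>y. y \<in> Rt \<inter> E \<Longrightarrow> eval q y = \<zero>"
    using Irr_cofactor[OF E x(1)] x(2) by metis
  have "card (Rt \<inter> E) \<le> degree q"
    using card_le_degree[of q "Rt \<inter> E"] q(2,4) Rt_carrier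
      carrier_polynomial_shell[OF subfieldE(1)[OF E(1)] q(1)] by blast
  then show ?thesis using q(3) by simp
qed

end

section \<open>Embeddings of a subfield and their extension to simple extensions\<close>

locale subfield_embedding = field L for L (structure) +
  fixes E :: "'a set" and \<sigma> :: "'a \<Rightarrow> 'a"
  assumes E_subfield: "subfield E L"
    and \<sigma>_hom: "\<sigma> \<in> ring_hom (L\<lparr>carrier := E\<rparr>) L"
begin

lemma E_carrier: "E \<subseteq> carrier L"
  using subfieldE(3)[OF E_subfield] .

sublocale hom: ring_hom_ring "L\<lparr>carrier := E\<rparr>" L \<sigma>
  using ring_hom_ringI2[OF subring_is_ring[OF subfieldE(1)[OF E_subfield]] ring_axioms \<sigma>_hom] .

lemma hom_one: "\<sigma> \<one> = \<one>"
  using hom.hom_one by simp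

lemma hom_add: "x \<in> E \<Longrightarrow> y \<in> E \<Longrightarrow> \<sigma> (x \<oplus> y) = \<sigma> x \<oplus> \<sigma> y"
  using hom.hom_add by simp

lemma hom_mult: "x \<in> E \<Longrightarrow> y \<in> E \<Longrightarrow> \<sigma> (x \<otimes> y) = \<sigma> x \<otimes> \<sigma> y"
  using hom.hom_mult by simp

lemma hom_zero: "\<sigma> \<zero> = \<zero>"
  using hom.hom_zero by simp

lemma hom_closed: "x \<in> E \<Longrightarrow> \<sigma> x \<in> carrier L"
  using hom.hom_closed by simp

lemma inj: "inj_on \<sigma> E"
  using non_trivial_field_hom_is_inj[OF \<sigma>_hom subfield_iff(2)[OF E_subfield] field_axioms] by simp

lemma hom_uminus:
  assumes "x \<in> E"
  shows "\<sigma> (\<ominus> x) = \<ominus> \<sigma> x"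
proof -
  have m: "\<ominus> x \<in> E" using subringE(5)[OF subfieldE(1)[OF E_subfield] assms] .
  have "\<sigma> (\<ominus> x) \<oplus> \<sigma> x = \<zero>"
    using hom_add[OF m assms] hom_zero assms E_carrier by (auto simp: l_neg)
  then show ?thesis
    using minus_equality hom_closed[OF m] hom_closed[OF assms] by metis
qed

lemma hom_inv:
  assumes "x \<in> E" "x \<noteq> \<zero>"
  shows "\<sigma> (inv x) = inv (\<sigma> x)"
proof -
  have i: "inv x \<in> E" "inv x \<otimes> x = \<one>"
    using subfield_m_inv[OF E_subfield] assms by auto
  then have "\<sigma> x \<otimes> \<sigma> (inv x) = \<one>"
    using hom_mult[OF i(1) assms(1)] hom_one hom_closed assms(1) by (simp add: m_comm)
  then show ?thesis
    using comm_inv_char[OF hom_closed[OF assms(1)] hom_closed[OF i(1)]] by simp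
qed

text \<open>Membership in \<open>E\<close> is part of the induction because the homomorphism laws
  for \<open>\<sigma>\<close> hold only there.\<close>

lemma image_generate_field:
  assumes "H \<subseteq> E" "x \<in> generate_field L H"
  shows "x \<in> E \<and> \<sigma> x \<in> generate_field L (\<sigma> ` H)"
  using assms(2)
proof induct
  case one
  then show ?case
    using hom_one subringE(3)[OF subfieldE(1)[OF E_subfield]] generate_field.one[of L] by simp
next
  case (incl h)
  then show ?case
    using assms(1) by (auto intro: generate_field.incl)
next
  case (a_inv h)
  then show ?case
    by (auto simp: hom_uminus intro: subringE(5)[OF subfieldE(1)[OF E_subfield]] generate_field.a_inv)
next
  case (m_inv h)
  have "\<sigma> h \<noteq> \<zero>"
    using m_inv inj hom_zero subringE(2)[OF subfieldE(1)[OF E_subfield]] by (metis inj_onD)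
  then show ?case
    using m_inv hom_inv[of h] subfield_m_inv(1)[OF E_subfield, of h] by (auto intro: generate_field.m_inv)
next
  case (eng_add h1 h2)
  then show ?case
    by (auto simp: hom_add intro: subringE(7)[OF subfieldE(1)[OF E_subfield]] generate_field.eng_add)
next
  case (eng_mult h1 h2)
  then show ?case
    by (auto simp: hom_mult intro: subringE(6)[OF subfieldE(1)[OF E_subfield]] generate_field.eng_mult)
qed

lemma image_subfield:
  assumes "subfield S L" "S \<subseteq> E"
  shows "subfield (\<sigma> ` S) L"
proof -
  have "subring S (L\<lparr>carrier := E\<rparr>)"
    using ring.ring_incl_imp_subring[OF hom.R.ring_axioms, of S] assms
      subring_is_ring[OF subfieldE(1)[OF assms(1)]] by simp
  then have sub: "subring (\<sigma> ` S) L"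
    by (rule hom.img_is_subring)
  show ?thesis
  proof (rule subfieldI'[OF sub])
    fix k assume "k \<in> \<sigma> ` S - {\<zero>}"
    then obtain x where x: "x \<in> S" "k = \<sigma> x" "x \<noteq> \<zero>"
      using hom_zero by auto
    then have "inv k = \<sigma> (inv x)" "inv x \<in> S"
      using hom_inv[of x] assms subfield_m_inv(1)[OF assms(1), of x] by auto
    then show "inv k \<in> \<sigma> ` S" by simp
  qed
qed

lemma map_polynomial:
  assumes "p \<in> carrier (E[X])"
  shows "map \<sigma> p \<in> carrier (poly_ring L)"
proof -
  have "set p \<subseteq> E" "p \<noteq> [] \<Longrightarrow> lead_coeff p \<noteq> \<zero>"
    using assms unfolding sym[OF univ_poly_carrier] polynomial_def by auto
  moreover have "\<sigma> x = \<zero> \<Longrightarrow> x = \<zero>" if "x \<in> E" for x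
    using that inj hom_zero subringE(2)[OF subfieldE(1)[OF E_subfield]] by (metis inj_onD)
  ultimately show ?thesis
    unfolding sym[OF univ_poly_carrier] polynomial_def using hom_closed by (cases p) auto
qed

lemma map_eval:
  assumes "p \<in> carrier (E[X])" "x \<in> E"
  shows "eval (map \<sigma> p) (\<sigma> x) = \<sigma> (eval p x)"
proof -
  have "set p \<subseteq> E"
    using assms(1) unfolding sym[OF univ_poly_carrier] polynomial_def by auto
  then show ?thesis
    using hom.eval_hom'[of x p] assms(2) eval_consistent[OF subfieldE(1)[OF E_subfield]] by simp
qed

text \<open>Applying \<open>\<sigma>\<close> to the coefficients and evaluating at \<open>y\<close>
  is the map that is later factored through evaluation at \<open>x\<close> in order to extend
  \<open>\<sigma>\<close>.\<close>

lemma map_eval_hom: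
  assumes "y \<in> carrier L"
  shows "ring_hom_ring (E[X]) L (\<lambda>p. eval (map \<sigma> p) y)"
proof (rule ring_hom_ringI2)
  show "ring (E[X])" using univ_poly_is_ring[OF subfieldE(1)[OF E_subfield]] .
  show "ring L" by (rule ring_axioms)
  have set: "set p \<subseteq> E" "set (map \<sigma> p) \<subseteq> carrier L" if "p \<in> carrier (E[X])" for p
    using that hom_closed unfolding sym[OF univ_poly_carrier] polynomial_def by auto
  show "(\<lambda>p. eval (map \<sigma> p) y) \<in> ring_hom (E[X]) L"
  proof (rule ring_hom_memI)
    fix p q assume pq: "p \<in> carrier (E[X])" "q \<in> carrier (E[X])"
    have add: "poly_add p q \<in> carrier (E[X])" and mult: "poly_mult p q \<in> carrier (E[X])"
      using poly_add_closed[OF subfieldE(1)[OF E_subfield]] poly_mult_closed[OF subfieldE(1)[OF E_subfield]]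
        pq unfolding univ_poly_carrier by blast+
    \<comment> \<open>Sums of mapped lists are compared with mapped sums after normalisation, which
      leaves values unchanged.\<close>
    have "eval (map \<sigma> (poly_add p q)) y = eval (normalize (map \<sigma> (poly_add p q))) y"
      using eval_normalize[OF set(2)[OF add] assms] by simp
    also have "\<dots> = eval (poly_add (map \<sigma> p) (map \<sigma> q)) y"
      using hom.poly_add_hom'[of p q] set[OF pq(1)] set[OF pq(2)]
        poly_add_consistent[OF subfieldE(1)[OF E_subfield]] by simp
    also have "\<dots> = eval (map \<sigma> p) y \<oplus> eval (map \<sigma> q) y"
      using eval_poly_add[OF set(2)[OF pq(1)] set(2)[OF pq(2)] assms] .
    finally show "eval (map \<sigma> (p \<oplus>\<^bsub>E[X]\<^esub> q)) y = eval (map \<sigma> p) y \<oplus> eval (map \<sigma> q) y"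
      unfolding univ_poly_add .
    have "eval (map \<sigma> (poly_mult p q)) y = eval (normalize (map \<sigma> (poly_mult p q))) y"
      using eval_normalize[OF set(2)[OF mult] assms] by simp
    also have "\<dots> = eval (poly_mult (map \<sigma> p) (map \<sigma> q)) y"
      using hom.poly_mult_hom'[of p q] set[OF pq(1)] set[OF pq(2)]
        poly_mult_consistent[OF subfieldE(1)[OF E_subfield]] by simp
    also have "\<dots> = eval (map \<sigma> p) y \<otimes> eval (map \<sigma> q) y"
      using eval_poly_mult[OF set(2)[OF pq(1)] set(2)[OF pq(2)] assms] .
    finally show "eval (map \<sigma> (p \<otimes>\<^bsub>E[X]\<^esub> q)) y = eval (map \<sigma> p) y \<otimes> eval (map \<sigma> q) y"
      unfolding univ_poly_mult .
  qed (use set eval_in_carrier assms hom_one in \<open>auto simp: univ_poly_one\<close>)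
qed

text \<open>The extension sends \<open>p(x)\<close> to the value at \<open>y\<close> of the mapped
  polynomial. Two polynomials with equal value at \<open>x\<close> differ by a multiple of
  \<open>Irr E x\<close>, whose image vanishes at \<open>y\<close>, so the choice of
  \<open>p\<close> does not matter.\<close>

lemma extend_simple:
  assumes x: "x \<in> carrier L" "(algebraic over E) x"
    and y: "y \<in> carrier L" "eval (map \<sigma> (Irr E x)) y = \<zero>"
  obtains \<tau> where "\<tau> \<in> ring_hom (L\<lparr>carrier := simple_extension E x\<rparr>) L"
    "\<And>z. z \<in> E \<Longrightarrow> \<tau> z = \<sigma> z" "\<tau> x = y"
proof -
  interpret UP: domain "E[X]"
    using univ_poly_is_domain[OF subfieldE(1)[OF E_subfield]] .
  interpret H: ring_hom_ring "E[X]" L "\<lambda>p. eval (map \<sigma> p) y"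
    using map_eval_hom[OF y(1)] .
  interpret ev: ring_hom_ring "E[X]" L "\<lambda>p. eval p x"
    using eval_ring_hom[OF subfieldE(1)[OF E_subfield] x(1)] .
  note Irr = IrrE[OF E_subfield x]
  have well_defined: "eval (map \<sigma> p) y = eval (map \<sigma> q) y"
    if pq: "p \<in> carrier (E[X])" "q \<in> carrier (E[X])" "eval p x = eval q x" for p q
  proof -
    let ?d = "p \<ominus>\<^bsub>E[X]\<^esub> q"
    have d: "?d \<in> carrier (E[X])" using pq by simp
    have "eval ?d x = \<zero>"
      using pq eval_in_carrier by (simp add: a_minus_def r_neg)
    then obtain r where r: "r \<in> carrier (E[X])" "?d = Irr E x \<otimes>\<^bsub>E[X]\<^esub> r"
      using Irr_minimal[OF E_subfield x d] pdivides_iff_shell[OF E_subfield Irr(1) d]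
      unfolding factor_def by blast
    have "eval (map \<sigma> ?d) y = \<zero>"
      unfolding r(2) using H.hom_mult[OF Irr(1) r(1)] y(2) H.hom_closed[OF r(1)] by simp
    moreover have "p = ?d \<oplus>\<^bsub>E[X]\<^esub> q"
      using pq by (simp add: a_minus_def UP.a_assoc UP.l_neg)
    ultimately show ?thesis
      using H.hom_add[OF d pq(2)] H.hom_closed[OF pq(2)] by simp
  qed
  define \<tau> where "\<tau> z = eval (map \<sigma> (SOME p. p \<in> carrier (E[X]) \<and> eval p x = z)) y" for z
  have \<tau>: "\<tau> (eval p x) = eval (map \<sigma> p) y" if "p \<in> carrier (E[X])" for p
    unfolding \<tau>_def using someI[of "\<lambda>q. q \<in> carrier (E[X]) \<and> eval q x = eval p x" p] that
    by (intro well_defined) auto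
  have img: "\<exists>p \<in> carrier (E[X]). z = eval p x" if "z \<in> simple_extension E x" for z
    using that unfolding simple_extension_as_eval_img[OF E_carrier x(1)] by blast
  have "\<tau> \<in> ring_hom (L\<lparr>carrier := simple_extension E x\<rparr>) L"
  proof (rule ring_hom_memI)
    fix z w assume zw: "z \<in> carrier (L\<lparr>carrier := simple_extension E x\<rparr>)"
      "w \<in> carrier (L\<lparr>carrier := simple_extension E x\<rparr>)"
    obtain p q where p: "p \<in> carrier (E[X])" "z = eval p x" and q: "q \<in> carrier (E[X])" "w = eval q x"
      using img[of z] img[of w] zw by auto
    have "\<tau> (eval (p \<oplus>\<^bsub>E[X]\<^esub> q) x) = \<tau> z \<oplus> \<tau> w"
      using p q \<tau> H.hom_add UP.add.m_closed by metis
    then show "\<tau> (z \<oplus>\<^bsub>L\<lparr>carrier := simple_extension E x\<rparr>\<^esub> w) = \<tau> z \<oplus> \<tau> w"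
      using ev.hom_add[OF p(1) q(1)] p q by simp
    have "\<tau> (eval (p \<otimes>\<^bsub>E[X]\<^esub> q) x) = \<tau> z \<otimes> \<tau> w"
      using p q \<tau> H.hom_mult UP.m_closed by metis
    then show "\<tau> (z \<otimes>\<^bsub>L\<lparr>carrier := simple_extension E x\<rparr>\<^esub> w) = \<tau> z \<otimes> \<tau> w"
      using ev.hom_mult[OF p(1) q(1)] p q by simp
  next
    fix z assume "z \<in> carrier (L\<lparr>carrier := simple_extension E x\<rparr>)"
    then obtain p where "p \<in> carrier (E[X])" "z = eval p x"
      using img by auto
    then show "\<tau> z \<in> carrier L"
      using \<tau> H.hom_closed by simp
  next
    have "\<tau> (eval \<one>\<^bsub>E[X]\<^esub> x) = \<one>"
      using \<tau>[OF UP.one_closed] H.hom_one by simp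
    then show "\<tau> \<one>\<^bsub>L\<lparr>carrier := simple_extension E x\<rparr>\<^esub> = \<one>"
      using ev.hom_one by simp
  qed
  moreover have "\<tau> z = \<sigma> z" if z: "z \<in> E" for z
  \<comment> \<open>Zero is treated apart because the zero polynomial is \<open>[]\<close> and not
    \<open>[\<zero>]\<close>.\<close>
  proof (cases "z = \<zero>")
    case True
    then show ?thesis
      using \<tau>[of "[]"] hom_zero by (simp add: univ_poly_zero_closed)
  next
    case False
    then have "[z] \<in> carrier (E[X])"
      using z unfolding sym[OF univ_poly_carrier] polynomial_def by simp
    then show ?thesis
      using \<tau>[of "[z]"] z x(1) y(1) E_carrier hom_closed by auto
  qed
  moreover have "\<tau> x = y"
    using \<tau>[OF var_closed(1)[OF subfieldE(1)[OF E_subfield]]] x(1) y(1) eval_var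
    by (simp add: var_def hom_one hom_zero)
  ultimately show thesis using that by blast
qed

end

lemma (in subfield_embedding) fixes_generate_field:
  assumes "H \<subseteq> E" "\<And>x. x \<in> H \<Longrightarrow> \<sigma> x = x" "x \<in> generate_field L H"
  shows "\<sigma> x = x"
proof -
  note gen = image_generate_field[OF assms(1), THEN conjunct1]
  show ?thesis
    using assms(3)
  proof induct
    case (m_inv h)
    then show ?case using hom_inv[OF gen[OF m_inv(1)]] by simp
  qed (simp_all add: hom_one hom_uminus hom_add hom_mult gen assms(2))
qed

section \<open>Embeddings over \<open>K\<close> and the Galois group\<close>

context separable_irreducible
begin

abbreviation G where "G \<equiv> galois_group L K (splitting_field L K f)"

text \<open>Functions are total and only their values on \<open>F B\<close> matter. The target is
  all of \<open>L\<close>, so that an embedding can be extended root by root before its image is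
  identified.\<close>

definition K_embedding :: "'a set \<Rightarrow> ('a \<Rightarrow> 'a) \<Rightarrow> bool" where
  "K_embedding B \<phi> \<longleftrightarrow> \<phi> \<in> ring_hom (L\<lparr>carrier := F B\<rparr>) L \<and> (\<forall>x\<in>K. \<phi> x = x)"

lemma K_embedding_subfield_embedding:
  assumes "K_embedding B \<phi>" "B \<subseteq> Rt"
  shows "subfield_embedding L (F B) \<phi>"
  using assms F_subfield[of B] Rt_carrier unfolding K_embedding_def
  by (intro subfield_embedding.intro field_axioms subfield_embedding_axioms.intro) auto

lemma K_embedding_mono:
  assumes "K_embedding B \<phi>" "A \<subseteq> B" "B \<subseteq> Rt"
  shows "K_embedding A \<phi>"
proof -
  have "F A \<subseteq> F B" using F_mono assms(2,3) Rt_carrier by blast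
  then show ?thesis
    using assms(1) unfolding K_embedding_def ring_hom_def by (auto simp: Pi_iff subset_iff)
qed

lemma map_f:
  assumes "\<forall>x\<in>K. \<phi> x = x"
  shows "map \<phi> f = f"
  using f_carrier assms unfolding sym[OF univ_poly_carrier] polynomial_def by (auto intro!: map_idI)

lemma f_carrier_F: "f \<in> carrier ((F B)[X])"
  using f_carrier K_le_F[of B] unfolding sym[OF univ_poly_carrier] polynomial_def by auto

lemma K_embedding_root:
  assumes "K_embedding B \<phi>" "B \<subseteq> Rt" "x \<in> Rt" "x \<in> F B"
  shows "\<phi> x \<in> Rt"
proof -
  interpret subfield_embedding L "F B" \<phi>
    using K_embedding_subfield_embedding[OF assms(1,2)] .
  have "map \<phi> f = f" using map_f assms(1) by (simp add: K_embedding_def)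
  then have "eval f (\<phi> x) = \<phi> (eval f x)"
    using map_eval[OF f_carrier_F assms(4)] by simp
  then show ?thesis
    using assms(3) hom_zero hom_closed[OF assms(4)] by (simp add: Rt_iff)
qed

lemma K_embedding_image_roots:
  assumes "K_embedding B \<phi>" "B \<subseteq> Rt"
  shows "\<phi> ` B \<subseteq> Rt"
  using K_embedding_root[OF assms] assms(2) F_incl[of B] by blast

text \<open>The image of \<open>F B\<close> is a subfield containing \<open>K\<close> and the image
  of \<open>B\<close>, which gives one inclusion by minimality; the other follows by induction on
  the generation of elements.\<close>

lemma K_embedding_image:
  assumes "K_embedding B \<phi>" "B \<subseteq> Rt"
  shows "\<phi> ` F B = F (\<phi> ` B)"
proof
  interpret subfield_embedding L "F B" \<phi>
    using K_embedding_subfield_embedding[OF assms] .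
  have fixK: "\<phi> ` K = K" using assms(1) by (simp add: K_embedding_def)
  then have "\<phi> ` (K \<union> B) = K \<union> \<phi> ` B" by blast
  then show "\<phi> ` F B \<subseteq> F (\<phi> ` B)"
    using image_generate_field[of "K \<union> B"] K_le_F[of B] F_incl[of B] unfolding adjoin_def by auto
  have "K \<subseteq> \<phi> ` F B"
    using image_mono[OF K_le_F[of B], of \<phi>] unfolding fixK .
  then show "F (\<phi> ` B) \<subseteq> \<phi> ` F B"
    using K_embedding_image_roots[OF assms] Rt_carrier
    by (intro F_minimal image_subfield[OF E_subfield order_refl] image_mono F_incl) auto
qed

lemma K_embedding_insert:
  assumes "K_embedding B \<phi>" "B \<subseteq> Rt" "x \<in> Rt"
    and "y \<in> carrier L" "eval (map \<phi> (Irr (F B) x)) y = \<zero>"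
  obtains \<tau> where "K_embedding (insert x B) \<tau>" "\<And>z. z \<in> F B \<Longrightarrow> \<tau> z = \<phi> z" "\<tau> x = y"
proof -
  interpret subfield_embedding L "F B" \<phi>
    using K_embedding_subfield_embedding[OF assms(1,2)] .
  have x: "x \<in> carrier L" using assms(3) Rt_carrier by blast
  obtain \<tau> where \<tau>: "\<tau> \<in> ring_hom (L\<lparr>carrier := simple_extension (F B) x\<rparr>) L"
    "\<And>z. z \<in> F B \<Longrightarrow> \<tau> z = \<phi> z" "\<tau> x = y"
    using extend_simple[OF x algebraic_over[OF K_le_F x] assms(4,5)] by blast
  have "K_embedding (insert x B) \<tau>"
    using \<tau>(1,2) assms(1,2) F_insert[OF _ x, of B] K_le_F[of B] Rt_carrier
    unfolding K_embedding_def by auto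
  then show thesis using that \<tau> by blast
qed

text \<open>Roots are added one at a time: the mapped minimal polynomial of the next root has a zero
  because \<open>L\<close> is algebraically closed, and this zero serves as its image.\<close>

lemma K_embedding_extend_Un:
  assumes "finite A" "A \<subseteq> Rt" "K_embedding B \<phi>" "B \<subseteq> Rt"
  shows "\<exists>\<tau>. K_embedding (A \<union> B) \<tau> \<and> (\<forall>z\<in>F B. \<tau> z = \<phi> z)"
  using assms(1,2)
proof (induct A)
  case empty
  then show ?case using assms(3) by auto
next
  case (insert x A)
  then obtain \<tau> where \<tau>: "K_embedding (A \<union> B) \<tau>" "\<forall>z\<in>F B. \<tau> z = \<phi> z" by auto
  have AB: "A \<union> B \<subseteq> Rt" and x: "x \<in> Rt" "x \<in> carrier L"
    using insert assms(4) Rt_carrier by auto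
  then interpret subfield_embedding L "F (A \<union> B)" \<tau>
    using K_embedding_subfield_embedding[OF \<tau>(1)] by blast
  let ?p = "map \<tau> (Irr (F (A \<union> B)) x)"
  have p: "?p \<in> carrier (poly_ring L)"
    using map_polynomial[OF IrrE(1)[OF E_subfield x(2) algebraic_over[OF K_le_F x(2)]]] .
  have "size (roots ?p) \<ge> 1"
    using roots_over_carrier[OF p] Irr_over_pos[OF E_subfield K_le_F x(2)] by (simp add: splitted_def)
  then obtain y where "y \<in># roots ?p"
    by (metis multiset_nonemptyE not_one_le_zero size_empty)
  then have "y \<in> carrier L" "eval ?p y = \<zero>"
    using roots_mem_iff_is_root[OF p] by (auto simp: is_root_def)
  then obtain \<rho> where "K_embedding (insert x (A \<union> B)) \<rho>" "\<And>z. z \<in> F (A \<union> B) \<Longrightarrow> \<rho> z = \<tau> z"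
    using K_embedding_insert[OF \<tau>(1) AB x(1)] by metis
  moreover have "F B \<subseteq> F (A \<union> B)"
    using F_mono[of B "A \<union> B"] AB Rt_carrier by blast
  ultimately show ?case
    using \<tau>(2) by (metis Un_insert_left subsetD)
qed

lemma K_embedding_extend:
  assumes "K_embedding B \<phi>" "B \<subseteq> Rt"
  obtains \<tau> where "K_embedding Rt \<tau>" "\<And>z. z \<in> F B \<Longrightarrow> \<tau> z = \<phi> z"
  using K_embedding_extend_Un[OF finite_Rt order_refl assms] assms(2) by (auto simp: Un_absorb2)

text \<open>An injective self-map of the finite root set is bijective, so the splitting field, being
  generated by the roots, is mapped onto itself: this is normality.\<close>

lemma K_embedding_bij:
  assumes "K_embedding Rt \<phi>"
  shows "bij_betw \<phi> Rt Rt" "bij_betw \<phi> (F Rt) (F Rt)"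
proof -
  interpret subfield_embedding L "F Rt" \<phi>
    using K_embedding_subfield_embedding[OF assms order_refl] .
  have "inj_on \<phi> Rt"
    using inj_on_subset[OF inj F_incl] .
  then show "bij_betw \<phi> Rt Rt"
    using endo_inj_surj[OF finite_Rt K_embedding_image_roots[OF assms order_refl]]
    by (simp add: bij_betw_def)
  then show "bij_betw \<phi> (F Rt) (F Rt)"
    using inj K_embedding_image[OF assms order_refl] by (simp add: bij_betw_def)
qed

text \<open>Membership in \<open>Bij\<close> demands the value \<open>undefined\<close> outside the
  splitting field, which a total embedding need not have; restriction repairs this.\<close>

lemma restrict_in_G:
  assumes "K_embedding Rt \<phi>"
  shows "restrict \<phi> (F Rt) \<in> carrier G"
proof -
  interpret subfield_embedding L "F Rt" \<phi>
    using K_embedding_subfield_embedding[OF assms order_refl] .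
  have closed: "x \<oplus> y \<in> F Rt" "x \<otimes> y \<in> F Rt" if "x \<in> F Rt" "y \<in> F Rt" for x y
    using that subringE(6,7)[OF subfieldE(1)[OF E_subfield]] by auto
  have "restrict \<phi> (F Rt) \<in> ring_hom (L\<lparr>carrier := F Rt\<rparr>) (L\<lparr>carrier := F Rt\<rparr>)"
    using K_embedding_bij(2)[OF assms] closed hom_add hom_mult hom_one
      subringE(3)[OF subfieldE(1)[OF E_subfield]]
    by (intro ring_hom_memI) (auto simp: bij_betw_def)
  moreover have "restrict \<phi> (F Rt) \<in> Bij (F Rt)"
    using K_embedding_bij(2)[OF assms] by (auto simp: Bij_def bij_betw_restrict_eq)
  moreover have "\<forall>x\<in>K. restrict \<phi> (F Rt) x = x"
    using assms K_le_F[of Rt] by (auto simp: K_embedding_def)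
  ultimately show ?thesis
    by (simp add: galois_group_def splitting_field_def)
qed

lemma G_K_embedding:
  assumes "\<phi> \<in> carrier G"
  shows "K_embedding Rt \<phi>"
proof -
  have "\<phi> \<in> ring_hom (L\<lparr>carrier := F Rt\<rparr>) (L\<lparr>carrier := F Rt\<rparr>)" "\<forall>x\<in>K. \<phi> x = x"
    using assms by (auto simp: galois_group_def splitting_field_def)
  then show ?thesis
    using F_carrier[OF Rt_carrier] unfolding K_embedding_def ring_hom_def by auto
qed

section \<open>Multiple transitivity in terms of degrees of minimal polynomials\<close>

definition generic_degrees :: "nat \<Rightarrow> bool" where
  "generic_degrees k \<longleftrightarrow>
     (\<forall>B \<beta>. B \<subseteq> Rt \<longrightarrow> card B < k \<longrightarrow> \<beta> \<in> Rt - B \<longrightarrow> degree (Irr (F B) \<beta>) = degree f - card B)"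

lemma generic_degreesD:
  "generic_degrees k \<Longrightarrow> B \<subseteq> Rt \<Longrightarrow> card B < k \<Longrightarrow> \<beta> \<in> Rt - B \<Longrightarrow>
    degree (Irr (F B) \<beta>) = degree f - card B"
  unfolding generic_degrees_def by blast

text \<open>From \<open>card B < k\<close> and \<open>k < degree f\<close> the degree of
  \<open>\<beta>\<close> over \<open>F B\<close> is at least two, not merely positive.\<close>

lemma generic_degrees_not_in_F:
  assumes "generic_degrees k" "k < degree f" "B \<subseteq> Rt" "card B < k" "\<beta> \<in> Rt - B"
  shows "\<beta> \<notin> F B"
proof -
  have \<beta>: "\<beta> \<in> carrier L" and B: "B \<subseteq> carrier L" using assms(3,5) Rt_carrier by auto
  have "degree (Irr (F B) \<beta>) \<noteq> 1"
    using generic_degreesD[OF assms(1,3-5)] assms(2,4) by simp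
  then show ?thesis
    using Irr_degree_one_iff[OF F_subfield[OF B] \<beta> algebraic_over[OF K_le_F \<beta>]] by blast
qed

text \<open>Induction on the tuple: the field generated by the earlier entries is already mapped as
  prescribed, and the next root \<open>x\<close> can be sent to \<open>y\<close> as soon as
  \<open>y\<close> is a zero of the mapped minimal polynomial of \<open>x\<close>.\<close>

lemma generic_degrees_embedding:
  assumes "generic_degrees k" "k < degree f"
    and "length as \<le> k" "distinct as" "set as \<subseteq> Rt"
    and "length bs = length as" "distinct bs" "set bs \<subseteq> Rt"
  shows "\<exists>\<phi>. K_embedding (set as) \<phi> \<and> map \<phi> as = bs"
  using assms(3-)
proof (induct as arbitrary: bs rule: rev_induct)
  case Nil
  have "K_embedding {} (\<lambda>x. x)"
    unfolding K_embedding_def ring_hom_def using F_carrier[of "{}"] by auto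
  then show ?case using Nil by auto
next
  case (snoc x as)
  obtain cs y where bs: "bs = cs @ [y]" "length cs = length as"
    using snoc(5) by (cases bs rule: rev_cases) auto
  then obtain \<phi> where \<phi>: "K_embedding (set as) \<phi>" "map \<phi> as = cs"
    using snoc(1)[of cs] snoc(2-) by auto
  let ?E = "F (set as)"
  have as: "set as \<subseteq> Rt" "x \<in> Rt" "x \<notin> set as" "card (set as) = length as" "length as < k"
    using snoc(2-4) by (auto simp: distinct_card)
  have y: "y \<in> Rt" "y \<notin> set cs" "set cs \<subseteq> Rt" "card (set cs) = length as"
    using snoc(5-7) bs by (auto simp: distinct_card)
  interpret subfield_embedding L ?E \<phi>
    using K_embedding_subfield_embedding[OF \<phi>(1) as(1)] .
  have xE: "x \<notin> ?E"
    using generic_degrees_not_in_F[OF assms(1,2) as(1)] as by simp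
  obtain q where q: "q \<in> carrier (?E[X])" "q \<noteq> []" "f = Irr ?E x \<otimes>\<^bsub>?E[X]\<^esub> q"
    "degree f = degree (Irr ?E x) + degree q" "\<And>z. z \<in> Rt \<inter> ?E \<Longrightarrow> eval q z = \<zero>"
    using Irr_cofactor[OF E_subfield K_le_F as(2)] xE by metis
  have deg_q: "degree q = length as"
  proof -
    have "degree (Irr ?E x) = degree f - length as"
      using generic_degreesD[OF assms(1) as(1), of x] as by simp
    then show ?thesis using q(4) as(5) assms(2) by linarith
  qed
  have yL: "y \<in> carrier L" "eval f y = \<zero>" using y(1) by (auto simp: Rt_iff)
  have x: "x \<in> carrier L" using as(2) Rt_carrier by blast
  interpret H: ring_hom_ring "?E[X]" L "\<lambda>p. eval (map \<phi> p) y"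
    using map_eval_hom[OF yL(1)] .
  note Irr = IrrE(1)[OF E_subfield x algebraic_over[OF K_le_F x]]
  have "eval (map \<phi> f) y = \<zero>"
    using map_f[of \<phi>] \<phi>(1) yL(2) by (simp add: K_embedding_def)
  then have "eval (map \<phi> (Irr ?E x)) y \<otimes> eval (map \<phi> q) y = \<zero>"
    using H.hom_mult[OF Irr q(1)] q(3) by simp
  then have or: "eval (map \<phi> (Irr ?E x)) y = \<zero> \<or> eval (map \<phi> q) y = \<zero>"
    using integral[OF _ H.hom_closed[OF Irr] H.hom_closed[OF q(1)]] by blast
  \<comment> \<open>Otherwise the mapped cofactor, of degree \<open>length as\<close>, would vanish
    at \<open>y\<close> and at the \<open>length as\<close> distinct roots in \<open>cs\<close>,
    which are images of roots in \<open>?E\<close>.\<close>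
  have "eval (map \<phi> q) y \<noteq> \<zero>"
  proof
    assume qy: "eval (map \<phi> q) y = \<zero>"
    have "eval (map \<phi> q) z = \<zero>" if z: "z \<in> insert y (set cs)" for z
    proof (cases "z = y")
      case False
      then obtain a where a: "a \<in> set as" "z = \<phi> a"
        using z \<phi>(2) by auto
      then have "a \<in> Rt \<inter> ?E" using as(1) F_incl by blast
      then show ?thesis
        using map_eval[OF q(1), of a] q(5) hom_zero a(2) by simp
    qed (use qy in simp)
    then have "card (insert y (set cs)) \<le> degree (map \<phi> q)"
      using y(1,3) Rt_carrier q(2) by (intro card_le_degree[OF map_polynomial[OF q(1)]]) auto
    then show False
      using y(2,4) deg_q by simp
  qed
  then obtain \<tau> where "K_embedding (insert x (set as)) \<tau>" "\<And>z. z \<in> ?E \<Longrightarrow> \<tau> z = \<phi> z" "\<tau> x = y"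
    using K_embedding_insert[OF \<phi>(1) as(1,2) yL(1)] or by metis
  moreover from this have "map \<tau> as = cs"
    using \<phi>(2) F_incl[of "set as"] by (auto intro!: map_cong simp: subset_iff)
  ultimately show ?case
    unfolding bs(1) by (intro exI[of _ \<tau>]) simp
qed

lemma k_transitive_if_generic_degrees:
  assumes "generic_degrees k" "k < degree f"
  shows "k_transitive k G Rt"
  unfolding k_transitive_def
proof (intro allI impI)
  fix as bs assume *: "length as = k \<and> distinct as \<and> set as \<subseteq> Rt \<and>
    length bs = k \<and> distinct bs \<and> set bs \<subseteq> Rt"
  then obtain \<phi> where \<phi>: "K_embedding (set as) \<phi>" "map \<phi> as = bs"
    using generic_degrees_embedding[OF assms, of as bs] by auto
  then obtain \<tau> where \<tau>: "K_embedding Rt \<tau>" "\<And>z. z \<in> F (set as) \<Longrightarrow> \<tau> z = \<phi> z"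
    using K_embedding_extend * by metis
  have "restrict \<tau> (F Rt) (as ! i) = bs ! i" if "i < k" for i
  proof -
    have "as ! i \<in> set as" using that * by simp
    then have "as ! i \<in> F (set as)" "as ! i \<in> F Rt"
      using F_incl[of "set as"] F_incl[of Rt] * by auto
    then show ?thesis
      using \<tau>(2) \<phi>(2) * that by (metis nth_map restrict_apply)
  qed
  then show "\<exists>\<phi>\<in>carrier G. \<forall>i<k. \<phi> (as ! i) = bs ! i"
    using restrict_in_G[OF \<tau>(1)] by blast
qed

lemma k_transitive_shorter:
  assumes "k_transitive k G Rt" "k \<le> degree f"
    and "length as \<le> k" "distinct as" "set as \<subseteq> Rt"
    and "length bs = length as" "distinct bs" "set bs \<subseteq> Rt"
  obtains \<phi> where "\<phi> \<in> carrier G" "map \<phi> as = bs"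
proof -
  have ext: "\<exists>cs. length (as @ cs) = k \<and> distinct (as @ cs) \<and> set (as @ cs) \<subseteq> Rt"
    if "length as \<le> k" "distinct as" "set as \<subseteq> Rt" for as
  proof -
    have "k - length as \<le> card (Rt - set as)"
      using that assms(2) card_roots by (simp add: card_Diff_subset distinct_card)
    then obtain C where C: "C \<subseteq> Rt - set as" "card C = k - length as" "finite C"
      using obtain_subset_with_card_n by metis
    then obtain cs where "set cs = C" "distinct cs"
      using finite_distinct_list by blast
    then show ?thesis
      using C that by (intro exI[of _ cs]) (auto simp: distinct_card[symmetric])
  qed
  obtain cs where cs: "length (as @ cs) = k" "distinct (as @ cs)" "set (as @ cs) \<subseteq> Rt"
    using ext[OF assms(3-5)] by blast
  obtain ds where ds: "length (bs @ ds) = k" "distinct (bs @ ds)" "set (bs @ ds) \<subseteq> Rt"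
    using ext[of bs] assms by auto
  obtain \<phi> where \<phi>: "\<phi> \<in> carrier G" "\<And>i. i < k \<Longrightarrow> \<phi> ((as @ cs) ! i) = (bs @ ds) ! i"
    using assms(1) cs ds unfolding k_transitive_def by blast
  have "map \<phi> as = bs"
  proof (rule nth_equalityI)
    fix i assume "i < length (map \<phi> as)"
    then show "map \<phi> as ! i = bs ! i"
      using \<phi>(2)[of i] assms(3,6) by (simp add: nth_append)
  qed (simp add: assms(6))
  then show thesis using that \<phi>(1) by blast
qed

text \<open>All roots outside \<open>B\<close> are conjugate over \<open>F B\<close>, hence zeros of
  the minimal polynomial of \<open>\<beta>\<close>. This bounds its degree from below, and
  \<open>Irr_degree_bound\<close> does so from above.\<close>

lemma generic_degrees_if_k_transitive:
  assumes "k_transitive k G Rt" "k < degree f"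
  shows "generic_degrees k"
  unfolding generic_degrees_def
proof (intro allI impI)
  fix B \<beta> assume B: "B \<subseteq> Rt" "card B < k" and \<beta>: "\<beta> \<in> Rt - B"
  obtain as where as: "set as = B" "distinct as"
    using finite_distinct_list[OF finite_subset[OF B(1) finite_Rt]] by blast
  have len: "length as = card B" using as distinct_card by fastforce
  have \<beta>L: "\<beta> \<in> carrier L" and BL: "B \<subseteq> carrier L" using B \<beta> Rt_carrier by auto
  note sub = F_subfield[OF BL]
  note alg = algebraic_over[OF K_le_F \<beta>L, of B]
  note Irr = IrrE[OF sub \<beta>L alg]
  have root: "eval (Irr (F B) \<beta>) \<gamma> = \<zero>" if \<gamma>: "\<gamma> \<in> Rt - B" for \<gamma>
  proof -
    \<comment> \<open>\<open>card B < k\<close> leaves room for one entry after a listing of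
      \<open>B\<close>. The automorphism fixes \<open>B\<close> pointwise, hence the coefficients of
      the minimal polynomial, and moves \<open>\<beta>\<close> to \<open>\<gamma>\<close>.\<close>
    obtain \<phi> where \<phi>: "\<phi> \<in> carrier G" "map \<phi> (as @ [\<beta>]) = as @ [\<gamma>]"
      using k_transitive_shorter[OF assms(1), of "as @ [\<beta>]" "as @ [\<gamma>]"] assms(2) B \<beta> \<gamma> as len by auto
    have emb: "K_embedding Rt \<phi>" using G_K_embedding[OF \<phi>(1)] .
    have insB: "insert \<beta> B \<subseteq> Rt" using B \<beta> by blast
    have E\<beta>: "K_embedding (insert \<beta> B) \<phi>" using K_embedding_mono[OF emb insB order_refl] .
    interpret subfield_embedding L "F (insert \<beta> B)" \<phi>
      using K_embedding_subfield_embedding[OF E\<beta> insB] .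
    have "\<forall>x\<in>B. \<phi> x = x" using \<phi>(2) as(1) map_eq_conv[of \<phi> as id] by auto
    then have fixF: "\<phi> x = x" if "x \<in> F B" for x
      using that fixes_generate_field[of "K \<union> B" x] emb K_le_F[of "insert \<beta> B"] F_incl[of "insert \<beta> B"]
      unfolding adjoin_def K_embedding_def by auto
    have mono: "F B \<subseteq> F (insert \<beta> B)" using F_mono[of B "insert \<beta> B"] BL \<beta>L by blast
    have set: "set (Irr (F B) \<beta>) \<subseteq> F B"
      using Irr(1) unfolding sym[OF univ_poly_carrier] polynomial_def by auto
    have "Irr (F B) \<beta> \<in> carrier ((F (insert \<beta> B))[X])"
      using Irr(1) mono unfolding sym[OF univ_poly_carrier] polynomial_def by auto
    moreover have "map \<phi> (Irr (F B) \<beta>) = Irr (F B) \<beta>"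
      using fixF set by (auto intro!: map_idI)
    ultimately have "eval (Irr (F B) \<beta>) (\<phi> \<beta>) = \<phi> (eval (Irr (F B) \<beta>) \<beta>)"
      using map_eval[of "Irr (F B) \<beta>" \<beta>] F_incl[of "insert \<beta> B"] by simp
    then show ?thesis using Irr(4) hom_zero \<phi>(2) by simp
  qed
  have card: "card (Rt - B) = degree f - card B"
    using card_roots B(1) finite_Rt by (simp add: card_Diff_subset finite_subset)
  have "card (Rt - B) \<le> degree (Irr (F B) \<beta>)"
    using root Rt_carrier pirreducibleE(1)[OF subfieldE(1)[OF sub] Irr(1,2)]
      carrier_polynomial_shell[OF subfieldE(1)[OF sub] Irr(1)]
    by (intro card_le_degree) auto
  then have le: "degree f - card B \<le> degree (Irr (F B) \<beta>)" unfolding card .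
  \<comment> \<open>The lower bound is at least two, which excludes \<open>\<beta>\<close> from
    \<open>F B\<close> as the upper bound requires.\<close>
  then have "\<beta> \<notin> F B"
    using Irr_degree_one_iff[OF sub \<beta>L alg] assms(2) B(2) by linarith
  moreover have "card B \<le> card (Rt \<inter> F B)"
    using B(1) F_incl[of B] finite_Rt by (intro card_mono) auto
  ultimately show "degree (Irr (F B) \<beta>) = degree f - card B"
    using Irr_degree_bound[OF sub K_le_F, of \<beta>] \<beta> le by simp
qed

end

section \<open>Cluster towers and multiple transitivity\<close>

lemma nPr_0 [simp]: "nPr n 0 = 1"
  by (simp add: nPr_def)

lemma nPr_Suc: "nPr n (Suc j) = nPr n j * (n - j)"
  by (simp add: nPr_def mult.commute)

lemma nPr_pos: "j \<le> n \<Longrightarrow> nPr n j > 0"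
  by (auto simp: nPr_def intro!: prod_pos)

lemma nPr_eq_card_distinct_lists:
  assumes "finite A" "j \<le> card A"
  shows "card {xs. length xs = j \<and> distinct xs \<and> set xs \<subseteq> A} = nPr (card A) j"
proof -
  \<comment> \<open>Substituting \<open>card A - i\<close> for \<open>i\<close> turns the falling
    factorial into a product over an interval.\<close>
  have "nPr (card A) j = (\<Prod>i\<in>{card A - j + 1..card A}. i)"
    unfolding nPr_def using assms(2)
    by (intro prod.reindex_bij_witness[of _ "\<lambda>i. card A - i" "\<lambda>i. card A - i"]) auto
  then show ?thesis
    using card_lists_distinct_length_eq[OF assms] by simp
qed

text \<open>The last compared pair is \<open>xs ! (j - 1)\<close> and \<open>xs ! j\<close>, so the
  first entry of the remaining list cannot merge with the prefix.\<close>

lemma remdups_adj_take_drop: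
  assumes "j < length xs" "\<And>i. i < j \<Longrightarrow> xs ! i \<noteq> xs ! Suc i"
  shows "remdups_adj xs = take j xs @ remdups_adj (drop j xs)"
  using assms
proof (induct xs arbitrary: j)
  case (Cons x xs)
  show ?case
  proof (cases j)
    case (Suc j')
    then obtain y ys where xs: "xs = y # ys" using Cons(2) by (cases xs) auto
    have "x \<noteq> y" using Cons(3)[of 0] Suc xs by simp
    moreover have "remdups_adj xs = take j' xs @ remdups_adj (drop j' xs)"
      using Cons(1)[of j'] Cons(2) Cons(3)[of "Suc _"] Suc by auto
    ultimately show ?thesis using Suc xs by simp
  qed simp
qed simp

text \<open>The index \<open>m\<close> counts the repetitions of \<open>x\<close> at the head of
  \<open>xs\<close>; in a tower these are the steps that add nothing.\<close>

lemma remdups_adj_second: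
  assumes "length (remdups_adj (x # xs)) \<ge> 2"
  shows "\<exists>m<length xs. xs ! m \<noteq> x \<and> (\<forall>i<m. xs ! i = x) \<and> remdups_adj (x # xs) ! 1 = xs ! m"
  using assms
proof (induct xs)
  case (Cons y ys)
  show ?case
  proof (cases "y = x")
    case True
    then obtain m where "m < length ys" "ys ! m \<noteq> x" "\<forall>i<m. ys ! i = x"
      "remdups_adj (x # ys) ! 1 = ys ! m"
      using Cons by auto
    then show ?thesis
      using True by (intro exI[of _ "Suc m"]) (auto simp: nth_Cons split: nat.split)
  next
    case False
    then have "remdups_adj (x # y # ys) ! 1 = y"
      using remdups_adj_Cons'[of y ys] by simp
    then show ?thesis
      using False by (intro exI[of _ 0]) auto
  qed
qed simp

text \<open>Each entry is the only new element when a prefix grows by one. This serves to recover a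
  list of roots from a tower of fields.\<close>

lemma distinct_lists_eqI:
  assumes "distinct xs" "distinct ys" "length xs = length ys"
    and "\<And>j. j \<le> length xs \<Longrightarrow> set (take j xs) = set (take j ys)"
  shows "xs = ys"
proof (rule nth_equalityI)
  fix j assume j: "j < length xs"
  have "xs ! j \<in> set (take (Suc j) xs)"
    using j by (simp add: take_Suc_conv_app_nth)
  moreover have "xs ! j \<notin> set (take j ys)"
    using distinct_take[OF assms(1), of "Suc j"] assms(4)[of j] j by (simp add: take_Suc_conv_app_nth)
  ultimately show "xs ! j = ys ! j"
    using assms(3) assms(4)[of "Suc j"] j by (auto simp: take_Suc_conv_app_nth)
qed (rule assms(3))

lemma length_tower_of: "length (tower_of L K bs) = Suc (length bs)"
  by (simp add: tower_of_def)

lemma nth_tower_of: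
  "i \<le> length bs \<Longrightarrow> tower_of L K bs ! i = adjoin L K (set (take i bs))"
  unfolding tower_of_def by (simp add: nth_append del: upt_Suc)

section \<open>Root clusters and orderings of representatives\<close>

context separable_irreducible
begin

definition cluster_rel where
  "cluster_rel = {(\<alpha>, \<beta>). \<alpha> \<in> Rt \<and> \<beta> \<in> Rt \<and> F {\<alpha>} = F {\<beta>}}"

lemma root_clusters_eq: "root_clusters L K f = Rt // cluster_rel"
  by (simp add: root_clusters_def cluster_rel_def)

lemma equiv_cluster_rel: "equiv Rt cluster_rel"
  by (rule equivI) (auto simp: cluster_rel_def refl_on_def sym_def trans_def)

text \<open>The class of \<open>\<alpha>\<close> is represented by \<open>\<alpha>\<close> itself
  and every other class by an arbitrary element, so a tower can be started with any prescribed
  root.\<close>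

lemma cluster_ordering_starting_with:
  assumes "\<alpha> \<in> Rt"
  obtains bs where "cluster_ordering L K f (\<alpha> # bs)"
proof -
  define rep where "rep C = (if \<alpha> \<in> C then \<alpha> else SOME \<beta>. \<beta> \<in> C)" for C
  let ?CC = "root_clusters L K f"
  have ne: "C \<noteq> {}" if "C \<in> ?CC" for C
    using that in_quotient_imp_non_empty[OF equiv_cluster_rel] by (simp add: root_clusters_eq)
  have sub: "C \<subseteq> Rt" if "C \<in> ?CC" for C
    using that in_quotient_imp_subset[OF equiv_cluster_rel] by (simp add: root_clusters_eq)
  have disj: "C = D" if "C \<in> ?CC" "D \<in> ?CC" "x \<in> C" "x \<in> D" for C D x
    using that quotient_disj[OF equiv_cluster_rel, of C D] by (auto simp: root_clusters_eq)
  have rep: "rep C \<in> C" if "C \<in> ?CC" for C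
    using ne[OF that] unfolding rep_def by (auto intro: someI)
  have \<alpha>C: "cluster_rel `` {\<alpha>} \<in> ?CC" "\<alpha> \<in> cluster_rel `` {\<alpha>}"
    using assms equiv_class_self[OF equiv_cluster_rel assms] by (auto simp: root_clusters_eq quotientI)
  have S: "rep ` ?CC \<subseteq> Rt" using rep sub by blast
  obtain bs where bs: "set bs = rep ` ?CC - {\<alpha>}" "distinct bs"
    using finite_distinct_list[of "rep ` ?CC - {\<alpha>}"] finite_subset[OF S finite_Rt] by blast
  have "rep (cluster_rel `` {\<alpha>}) = \<alpha>" using \<alpha>C(2) by (simp add: rep_def)
  then have "\<alpha> \<in> rep ` ?CC" using \<alpha>C(1) by (metis imageI)
  then have set: "set (\<alpha> # bs) = rep ` ?CC" using bs(1) by auto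
  have "\<exists>!\<beta>. \<beta> \<in> rep ` ?CC \<and> \<beta> \<in> C" if C: "C \<in> ?CC" for C
  proof (rule ex1I[of _ "rep C"])
    fix \<beta> assume "\<beta> \<in> rep ` ?CC \<and> \<beta> \<in> C"
    then obtain D where "D \<in> ?CC" "\<beta> = rep D" "\<beta> \<in> C" by blast
    then show "\<beta> = rep C" using disj[OF C, of D \<beta>] rep by metis
  qed (use rep[OF C] C in blast)
  then have "cluster_ordering L K f (\<alpha> # bs)"
    unfolding cluster_ordering_def set using S bs by auto
  then show thesis by (rule that)
qed

lemma Rt_not_empty: "Rt \<noteq> {}"
  using card_roots degree_f_pos by auto

lemma cluster_ordering_not_Nil:
  assumes "cluster_ordering L K f bs"
  shows "bs \<noteq> []"
proof -
  obtain \<alpha> where "\<alpha> \<in> Rt" using Rt_not_empty by blast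
  then have "cluster_rel `` {\<alpha>} \<in> root_clusters L K f"
    by (simp add: root_clusters_eq quotientI)
  then show ?thesis using assms unfolding cluster_ordering_def by fastforce
qed

lemma root_clusters_singletons:
  assumes "inj_on (\<lambda>\<alpha>. F {\<alpha>}) Rt"
  shows "root_clusters L K f = (\<lambda>\<alpha>. {\<alpha>}) ` Rt"
proof -
  have "cluster_rel `` {\<alpha>} = {\<alpha>}" if "\<alpha> \<in> Rt" for \<alpha>
    using that inj_onD[OF assms] by (auto simp: cluster_rel_def)
  then show ?thesis
    unfolding root_clusters_eq quotient_def by auto
qed

lemma cluster_ordering_singletons:
  assumes "inj_on (\<lambda>\<alpha>. F {\<alpha>}) Rt"
  shows "cluster_ordering L K f bs \<longleftrightarrow> distinct bs \<and> set bs = Rt"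
  unfolding cluster_ordering_def root_clusters_singletons[OF assms] by auto

lemma dim_take_Suc:
  assumes "set bs \<subseteq> Rt" "i < length bs"
  shows "dim K (F (set (take (Suc i) bs)))
    = dim K (F (set (take i bs))) * degree (Irr (F (set (take i bs))) (bs ! i))"
proof -
  have "set (take (Suc i) bs) = insert (bs ! i) (set (take i bs))"
    using assms(2) by (simp add: take_Suc_conv_app_nth)
  moreover have "bs ! i \<in> carrier L" "set (take i bs) \<subseteq> carrier L"
    using subsetD[OF assms(1) nth_mem[OF assms(2)]] assms(1) Rt_carrier set_take_subset[of i bs]
    by auto
  ultimately show ?thesis
    using dim_F_insert[of "set (take i bs)"] by simp
qed

section \<open>Degrees along cluster towers\<close>

definition generic_tower where
  "generic_tower k T \<longleftrightarrow> tower_length T \<ge> k \<and>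
     take k (degree_sequence L K T) = map (nPr (degree f)) [1..<Suc k]"

text \<open>Strong induction. The earlier steps are strict, so position \<open>j\<close> of the
  tower is also position \<open>j\<close> among the distinct fields, and the next prescribed degree
  determines the degree of the first strict step after it. Comparison with
  \<open>Irr_degree_bound\<close> shows that this step comes at once.\<close>

lemma generic_tower_step:
  assumes bs: "distinct bs" "set bs \<subseteq> Rt" and k: "k < degree f"
    and T: "generic_tower k (tower_of L K bs)" and "j < k"
  shows "j < length bs \<and> F (set (take j bs)) \<noteq> F (set (take (Suc j) bs)) \<and>
    dim K (F (set (take (Suc j) bs))) = nPr (degree f) (Suc j) \<and>
    Rt \<inter> F (set (take j bs)) = set (take j bs) \<and>
    degree (Irr (F (set (take j bs))) (bs ! j)) = degree f - j"
  using \<open>j < k\<close>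
proof (induct j rule: less_induct)
  case (less j)
  let ?T = "tower_of L K bs" and ?n = "degree f"
  have jbs: "j \<le> length bs"
    using less(1)[of "j - 1"] less(2) by (cases j) auto
  have dim_j: "dim K (F (set (take j bs))) = nPr ?n j"
    using less(1)[of "j - 1"] less(2) by (cases j) (auto simp: F_empty dim_K)
  have "?T ! i \<noteq> ?T ! Suc i" if "i < j" for i
    using less(1)[of i] less(2) that jbs by (simp add: nth_tower_of)
  then have rem: "remdups_adj ?T = take j ?T @ remdups_adj (drop j ?T)"
    using jbs by (intro remdups_adj_take_drop) (auto simp: length_tower_of)
  have drop: "drop j ?T = ?T ! j # drop (Suc j) ?T"
    using jbs by (simp add: Cons_nth_drop_Suc length_tower_of)
  have deg_seq: "take k (degree_sequence L K ?T) = map (nPr ?n) [1..<Suc k]"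
    using T by (simp add: generic_tower_def)
  have "length (take k (degree_sequence L K ?T)) = k"
    unfolding deg_seq by simp
  \<comment> \<open>\<open>tl\<close> drops the field \<open>K\<close>, so a degree sequence of at
    least \<open>k\<close> terms needs more than \<open>k\<close> distinct fields.\<close>
  then have len: "length (remdups_adj ?T) > k"
    using less(2) by (simp add: degree_sequence_def)
  have len_take: "length (take j ?T) = j"
    using jbs by (simp add: length_tower_of)
  have "length (remdups_adj (drop j ?T)) \<ge> 2"
    using len less(2) len_take unfolding rem by simp
  \<comment> \<open>Here \<open>m\<close> is the number of steps directly after position
    \<open>j\<close> that leave the field unchanged; \<open>bs ! (j + m)\<close> is the first
    representative that enlarges it.\<close>
  then obtain m where m: "m < length (drop (Suc j) ?T)" "drop (Suc j) ?T ! m \<noteq> ?T ! j"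
    "\<And>i. i < m \<Longrightarrow> drop (Suc j) ?T ! i = ?T ! j"
    "remdups_adj (drop j ?T) ! 1 = drop (Suc j) ?T ! m"
    using remdups_adj_second[of "?T ! j" "drop (Suc j) ?T"] unfolding drop by blast
  have jm: "j + m < length bs"
    using m(1) by (simp add: length_tower_of)
  let ?E = "F (set (take (j + m) bs))" and ?\<beta> = "bs ! (j + m)"
  have E: "?E = F (set (take j bs))"
  proof (cases m)
    case (Suc m')
    then show ?thesis using m(3)[of m'] jm by (simp add: length_tower_of nth_tower_of)
  qed simp
  have next_field: "?T ! (Suc j + m) = F (set (take (Suc (j + m)) bs))"
    using jm by (simp add: nth_tower_of)
  have "remdups_adj ?T ! Suc j = ?T ! (Suc j + m)"
    using m(1,4) len_take unfolding rem by (simp add: nth_append length_tower_of)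
  then have "degree_sequence L K ?T ! j = dim K (F (set (take (Suc (j + m)) bs)))"
    using len less(2) next_field by (simp add: degree_sequence_def nth_tl)
  moreover have "degree_sequence L K ?T ! j = nPr ?n (Suc j)"
  proof -
    have "degree_sequence L K ?T ! j = take k (degree_sequence L K ?T) ! j"
      using less(2) by simp
    also have "\<dots> = nPr ?n (Suc j)"
      unfolding deg_seq using less(2) by (simp del: upt_Suc)
    finally show ?thesis .
  qed
  ultimately have dim_next: "dim K (F (set (take (Suc (j + m)) bs))) = nPr ?n (Suc j)"
    by simp
  \<comment> \<open>The tower law and the prescribed degree share the nonzero factor
    \<open>nPr ?n j\<close>; cancelling it leaves the degree of a single step.\<close>
  then have "nPr ?n j * degree (Irr ?E ?\<beta>) = nPr ?n j * (?n - j)"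
    using dim_take_Suc[OF bs(2) jm] dim_j E by (simp only: nPr_Suc)
  then have deg: "degree (Irr ?E ?\<beta>) = ?n - j"
    using nPr_pos[of j ?n] less(2) k by simp
  have \<beta>: "?\<beta> \<in> Rt" "?\<beta> \<in> carrier L" and sub: "set (take (j + m) bs) \<subseteq> Rt"
    using subsetD[OF bs(2) nth_mem[OF jm]] bs(2) Rt_carrier set_take_subset[of "j + m" bs] by auto
  have subE: "subfield ?E L" using F_subfield sub Rt_carrier by blast
  \<comment> \<open>As \<open>j < k < ?n\<close>, the degree \<open>?n - j\<close> exceeds one. So
    the bound applies and leaves at most \<open>j\<close> roots in \<open>?E\<close>.\<close>
  have "?\<beta> \<notin> ?E"
    using Irr_degree_one_iff[OF subE \<beta>(2) algebraic_over[OF K_le_F \<beta>(2)]] deg less(2) k by linarith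
  then have "card (Rt \<inter> ?E) + (?n - j) \<le> ?n"
    using Irr_degree_bound[OF subE K_le_F \<beta>(1)] deg by simp
  then have card_le: "card (Rt \<inter> ?E) \<le> j"
    using less(2) k by linarith
  have "set (take (j + m) bs) \<subseteq> Rt \<inter> ?E"
    using sub F_incl by blast
  moreover have card_take: "card (set (take (j + m) bs)) = j + m"
    using bs(1) jm by (simp add: distinct_card)
  ultimately have "j + m \<le> card (Rt \<inter> ?E)"
    using card_mono[of "Rt \<inter> ?E"] finite_Rt by (metis finite_Int)
  \<comment> \<open>The field \<open>?E\<close> contains the \<open>j + m\<close> distinct roots
    adjoined so far but at most \<open>j\<close> roots in all, so no step was idle.\<close>
  then have "m = 0" using card_le by simp
  moreover have "Rt \<inter> ?E = set (take (j + m) bs)"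
    using \<open>set (take (j + m) bs) \<subseteq> Rt \<inter> ?E\<close> card_le card_take finite_Rt
    by (intro card_seteq[symmetric]) auto
  ultimately show ?case
    using jm dim_next deg m(2) next_field by (simp add: nth_tower_of length_tower_of)
qed

text \<open>For \<open>k = 1\<close> the set \<open>B\<close> is empty and irreducibility gives the
  degree. For larger \<open>k\<close>, towers starting at each root show that clusters are
  singletons; then the roots may be ordered freely, and the tower through \<open>B\<close> followed
  by \<open>\<beta>\<close> gives the degree.\<close>

lemma generic_degrees_if_generic_towers:
  assumes "0 < k" "k < degree f"
    and T: "\<And>T. T \<in> cluster_towers L K f \<Longrightarrow> generic_tower k T"
  shows "generic_degrees k"
  unfolding generic_degrees_def
proof (intro allI impI)
  fix B \<beta> assume B: "B \<subseteq> Rt" "card B < k" and \<beta>: "\<beta> \<in> Rt - B"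
  show "degree (Irr (F B) \<beta>) = degree f - card B"
  proof (cases "k = 1")
    case True
    then have "B = {}"
      using B finite_subset[OF B(1) finite_Rt] by simp
    then show ?thesis using degree_Irr_K \<beta> by (simp add: F_empty)
  next
    case False
    have tower: "generic_tower k (tower_of L K bs)" if "cluster_ordering L K f bs" for bs
      using T that by (auto simp: cluster_towers_def)
    have singletons: "inj_on (\<lambda>\<alpha>. F {\<alpha>}) Rt"
    proof (rule inj_onI)
      fix \<alpha> \<gamma> assume \<alpha>\<gamma>: "\<alpha> \<in> Rt" "\<gamma> \<in> Rt" "F {\<alpha>} = F {\<gamma>}"
      obtain bs where bs: "cluster_ordering L K f (\<alpha> # bs)"
        using cluster_ordering_starting_with[OF \<alpha>\<gamma>(1)] by blast
      \<comment> \<open>The step with index \<open>1\<close> is available because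
        \<open>k \<noteq> 1\<close>; it concerns the field generated by the first representative
        \<open>\<alpha>\<close>.\<close>
      have "Rt \<inter> F {\<alpha>} = {\<alpha>}"
        using generic_tower_step[OF _ _ assms(2) tower[OF bs], of 1] bs False assms(1)
        by (auto simp: cluster_ordering_def)
      moreover have "\<gamma> \<in> Rt \<inter> F {\<alpha>}" using \<alpha>\<gamma> F_incl[of "{\<gamma>}"] by simp
      ultimately show "\<alpha> = \<gamma>" by simp
    qed
    obtain as where as: "set as = B" "distinct as"
      using finite_distinct_list[OF finite_subset[OF B(1) finite_Rt]] by blast
    obtain cs where cs: "set cs = Rt - insert \<beta> B" "distinct cs"
      using finite_distinct_list[OF finite_Diff[OF finite_Rt]] by blast
    have ord: "cluster_ordering L K f (as @ \<beta> # cs)"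
      unfolding cluster_ordering_singletons[OF singletons] using as cs B(1) \<beta> by auto
    have len: "length as = card B" using as distinct_card by fastforce
    show ?thesis
      using generic_tower_step[OF _ _ assms(2) tower[OF ord], of "card B"] ord B(2) as(1) len
      by (auto simp: cluster_ordering_def nth_append)
  qed
qed

lemma generic_degrees_singletons:
  assumes "generic_degrees k" "2 \<le> k" "k < degree f"
  shows "inj_on (\<lambda>\<alpha>. F {\<alpha>}) Rt"
proof (rule inj_onI)
  fix \<alpha> \<beta> assume "\<alpha> \<in> Rt" "\<beta> \<in> Rt" "F {\<alpha>} = F {\<beta>}"
  then show "\<alpha> = \<beta>"
    using generic_degrees_not_in_F[OF assms(1,3), of "{\<alpha>}" \<beta>] assms(2) F_incl[of "{\<beta>}"] by auto
qed

text \<open>For \<open>k = 1\<close> an ordering only has to be nonempty; otherwise clusters are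
  singletons and it lists all roots, more than \<open>k\<close> of them.\<close>

lemma generic_degrees_length:
  assumes "generic_degrees k" "0 < k" "k < degree f" "cluster_ordering L K f bs"
  shows "k \<le> length bs"
proof (cases "k = 1")
  case True
  then show ?thesis using cluster_ordering_not_Nil[OF assms(4)] by (cases bs) auto
next
  case False
  then have "distinct bs \<and> set bs = Rt"
    using cluster_ordering_singletons[OF generic_degrees_singletons[OF assms(1) _ assms(3)]] assms(2,4)
    by simp
  then show ?thesis using card_roots assms(3) distinct_card by fastforce
qed

text \<open>Used to read the prefixes of an ordering, as sets, off the fields of its tower.\<close>

lemma generic_degrees_prefix:
  assumes "generic_degrees k" "k < degree f" "B \<subseteq> Rt" "card B < k"
  shows "Rt \<inter> F B = B"
  using generic_degrees_not_in_F[OF assms] assms(3) F_incl[of B] by blast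

text \<open>Each of the first \<open>k\<close> representatives is a new root, so step
  \<open>j\<close> is strict and multiplies the degree by \<open>degree f - j\<close>; the products
  are the falling factorials.\<close>

lemma generic_tower_if_generic_degrees:
  assumes gen: "generic_degrees k" and k: "0 < k" "k < degree f"
    and T: "T \<in> cluster_towers L K f"
  shows "generic_tower k T"
proof -
  obtain bs where bs: "cluster_ordering L K f bs" "T = tower_of L K bs"
    using T by (auto simp: cluster_towers_def)
  have kbs: "k \<le> length bs" using generic_degrees_length[OF gen k bs(1)] .
  have ds: "distinct bs" "set bs \<subseteq> Rt" using bs(1) by (auto simp: cluster_ordering_def)
  have new: "bs ! j \<in> Rt - set (take j bs)" if "j < k" for j
  proof -
    have "j < length bs" using that kbs by simp
    then show ?thesis
      using subsetD[OF ds(2) nth_mem[of j bs]] distinct_take[OF ds(1), of "Suc j"]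
      by (simp add: take_Suc_conv_app_nth)
  qed
  have sub: "set (take j bs) \<subseteq> Rt"
    and card: "card (set (take j bs)) = j" if "j < k" for j
    using ds that kbs set_take_subset[of j bs] by (auto simp: distinct_card)
  have dims: "dim K (F (set (take j bs))) = nPr (degree f) j" if "j \<le> k" for j
    using that
  proof (induct j)
    case (Suc j)
    then show ?case
      using dim_take_Suc[OF ds(2), of j] generic_degreesD[OF gen sub[of j] _ new[of j]] card[of j] kbs
      by (simp add: nPr_Suc)
  qed (simp add: F_empty dim_K)
  have strict: "F (set (take j bs)) \<subset> F (set (take (Suc j) bs))" if "j < k" for j
  proof -
    have "bs ! j \<notin> F (set (take j bs))"
      using generic_degrees_not_in_F[OF gen k(2) sub[OF that] _ new[OF that]] card[OF that] that by simp
    moreover have "bs ! j \<in> F (set (take (Suc j) bs))"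
      using F_incl[of "set (take (Suc j) bs)"] that kbs by (auto simp: take_Suc_conv_app_nth)
    moreover have "F (set (take j bs)) \<subseteq> F (set (take (Suc j) bs))"
      using ds(2) Rt_carrier set_take_subset[of "Suc j" bs] set_take_subset_set_take[of j "Suc j" bs]
      by (intro F_mono) auto
    ultimately show ?thesis by blast
  qed
  have T_nth: "T ! j = F (set (take j bs))" if "j \<le> k" for j
    using that kbs bs(2) by (simp add: nth_tower_of)
  have strict_T: "T ! j \<subset> T ! Suc j" if "j < k" for j
    using strict[OF that] T_nth[of j] T_nth[of "Suc j"] that by simp
  have len_T: "k < length T" using kbs bs(2) by (simp add: length_tower_of)
  have "{..<k} \<subseteq> {i. Suc i < length T \<and> T ! i \<subset> T ! Suc i}"
    using strict_T len_T by auto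
  moreover have "finite {i. Suc i < length T \<and> T ! i \<subset> T ! Suc i}"
    by (rule finite_subset[of _ "{..<length T}"]) auto
  ultimately have "card {..<k} \<le> tower_length T"
    unfolding tower_length_def by (intro card_mono)
  then have "k \<le> tower_length T" by simp
  moreover have "take k (degree_sequence L K T) = map (nPr (degree f)) [1..<Suc k]"
  proof -
    \<comment> \<open>The first \<open>k\<close> steps are strict, so the entries up to index
      \<open>k\<close> stay in place. Index \<open>i\<close> of the degree sequence belongs to
      \<open>T ! Suc i\<close> because \<open>tl\<close> removes \<open>K\<close>.\<close>
    have "remdups_adj T = take k T @ remdups_adj (drop k T)"
      using strict_T len_T by (intro remdups_adj_take_drop) blast+
    also have "drop k T = T ! k # drop (Suc k) T"
      using len_T by (simp add: Cons_nth_drop_Suc)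
    finally obtain us where us: "remdups_adj T = take k T @ T ! k # us"
      unfolding remdups_adj_Cons' by (rule that)
    then have rem: "remdups_adj T ! j = T ! j" if "j \<le> k" for j
      using that len_T by (cases "j = k") (auto simp: nth_append)
    have len: "length (remdups_adj T) > k" unfolding us using len_T by simp
    show ?thesis
    proof (rule nth_equalityI)
      fix i assume "i < length (take k (degree_sequence L K T))"
      then have i: "i < k" by simp
      then have "take k (degree_sequence L K T) ! i = dim K (T ! Suc i)"
        using len rem[of "Suc i"] by (simp add: degree_sequence_def nth_tl)
      then show "take k (degree_sequence L K T) ! i = map (nPr (degree f)) [1..<Suc k] ! i"
        using i dims[of "Suc i"] T_nth[of "Suc i"] by (simp del: upt_Suc)
    qed (use len in \<open>simp add: degree_sequence_def\<close>)
  qed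
  ultimately show ?thesis by (simp add: generic_tower_def)
qed

section \<open>Counting cluster towers\<close>

lemma finite_cluster_towers: "finite (cluster_towers L K f)"
proof (rule finite_subset)
  show "cluster_towers L K f \<subseteq> tower_of L K ` {bs. set bs \<subseteq> Rt \<and> distinct bs}"
    by (auto simp: cluster_towers_def cluster_ordering_def)
qed (simp add: finite_subset_distinct finite_Rt)

text \<open>Lists of \<open>k - 1\<close> distinct roots inject into the towers: each is extended to
  a cluster ordering, and intersecting the fields with the root set returns the prefix sets, hence
  the list. With length \<open>k - 1\<close> all prefixes have fewer than \<open>k\<close> elements,
  as \<open>generic_degrees_prefix\<close> demands.\<close>

lemma card_cluster_towers:
  assumes gen: "generic_degrees k" and k: "0 < k" "k < degree f"
  shows "nPr (degree f) (k - 1) \<le> card (cluster_towers L K f)"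
proof -
  let ?A = "{as. length as = k - 1 \<and> distinct as \<and> set as \<subseteq> Rt}"
  have "\<exists>bs. cluster_ordering L K f bs \<and> take (k - 1) bs = as" if as: "as \<in> ?A" for as
  \<comment> \<open>For \<open>k = 1\<close> the list is empty and any ordering will do; clusters
    need not be singletons then.\<close>
  proof (cases "k = 1")
    case True
    obtain \<alpha> where "\<alpha> \<in> Rt" using Rt_not_empty by blast
    then obtain bs where "cluster_ordering L K f (\<alpha> # bs)"
      using cluster_ordering_starting_with by blast
    then show ?thesis using True as by auto
  next
    case False
    obtain cs where "set cs = Rt - set as" "distinct cs"
      using finite_distinct_list[OF finite_Diff[OF finite_Rt]] by blast
    then have "cluster_ordering L K f (as @ cs)"
      using as cluster_ordering_singletons[OF generic_degrees_singletons[OF gen _ k(2)]] False k(1)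
      by auto
    then show ?thesis using as by (intro exI[of _ "as @ cs"]) simp
  qed
  then have "\<forall>as\<in>?A. \<exists>bs. cluster_ordering L K f bs \<and> take (k - 1) bs = as" by (rule ballI)
  from bchoice[OF this] obtain g
    where "\<forall>as\<in>?A. cluster_ordering L K f (g as) \<and> take (k - 1) (g as) = as" ..
  then have g: "\<And>as. as \<in> ?A \<Longrightarrow> cluster_ordering L K f (g as)"
    "\<And>as. as \<in> ?A \<Longrightarrow> take (k - 1) (g as) = as"
    by simp_all
  have recover: "Rt \<inter> tower_of L K (g as) ! j = set (take j as)" if "as \<in> ?A" "j \<le> k - 1" for as j
  proof -
    have "take j (g as) = take j as"
      using g(2)[OF that(1)] that(2) by (metis min.absorb1 take_take)
    moreover have "card (set (take j as)) < k" "set (take j as) \<subseteq> Rt"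
      using that k(1) set_take_subset[of j as] by (auto simp: distinct_card)
    ultimately show ?thesis
      using generic_degrees_prefix[OF gen k(2)] generic_degrees_length[OF gen k g(1)[OF that(1)]] that(2)
      by (simp add: nth_tower_of)
  qed
  have "inj_on (\<lambda>as. tower_of L K (g as)) ?A"
  proof (rule inj_onI)
    fix as as' assume *: "as \<in> ?A" "as' \<in> ?A" "tower_of L K (g as) = tower_of L K (g as')"
    then show "as = as'"
      using recover[OF *(1)] recover[OF *(2)] by (intro distinct_lists_eqI) auto
  qed
  then have "card ?A \<le> card (cluster_towers L K f)"
    using g(1) finite_cluster_towers by (intro card_inj_on_le) (auto simp: cluster_towers_def)
  then show ?thesis
    using nPr_eq_card_distinct_lists[OF finite_Rt, of "k - 1"] card_roots k(2) by simp
qed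

section \<open>Minimal generating sets\<close>

lemma exists_minimal_generating_set: "\<exists>B. minimal_generating_set L K f B"
proof -
  let ?P = "\<lambda>B. B \<subseteq> Rt \<and> F B = F Rt"
  \<comment> \<open>A generating set of roots of least cardinality is taken; \<open>Rt\<close> shows
    that there is one, and proper subsets of a finite set are smaller.\<close>
  obtain B where B: "?P B" "\<And>A. ?P A \<Longrightarrow> card B \<le> card A"
    using ex_has_least_nat[of ?P Rt card] by blast
  have "F A \<noteq> F Rt" if "A \<subset> B" for A
    using that B psubset_card_mono[OF finite_subset[OF _ finite_Rt] that] by (meson less_imp_le
        not_less order_trans psubset_imp_subset)
  then show ?thesis
    using B(1) by (auto simp: minimal_generating_set_def splitting_field_def)
qed

text \<open>A proper subset of the image is the image of a proper subset of \<open>B\<close>, and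
  injectivity on the splitting field carries equality of generated fields back to the
  preimages.\<close>

lemma minimal_generating_set_image:
  assumes "\<phi> \<in> carrier G" "minimal_generating_set L K f B"
  shows "minimal_generating_set L K f (\<phi> ` B)"
proof -
  have emb: "K_embedding Rt \<phi>" using G_K_embedding[OF assms(1)] .
  have B: "B \<subseteq> Rt" "F B = F Rt" and min: "\<And>A. A \<subset> B \<Longrightarrow> F A \<noteq> F Rt"
    using assms(2) by (auto simp: minimal_generating_set_def splitting_field_def)
  have img: "\<phi> ` F A = F (\<phi> ` A)" if "A \<subseteq> Rt" for A
    using K_embedding_image[OF K_embedding_mono[OF emb that order_refl] that] .
  have bij: "inj_on \<phi> (F Rt)" "\<phi> ` F Rt = F Rt"
    using K_embedding_bij(2)[OF emb] by (auto simp: bij_betw_def)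
  have "F A' \<noteq> F Rt" if A': "A' \<subset> \<phi> ` B" for A'
  proof
    assume gen: "F A' = F Rt"
    obtain A where A: "A \<subseteq> B" "A' = \<phi> ` A" using A' by (meson subset_imageE psubset_imp_subset)
    then have "A \<subset> B" using A' by blast
    have AR: "A \<subseteq> Rt" using A(1) B(1) by blast
    have "\<phi> ` F A = \<phi> ` F Rt" using img[OF AR] gen A(2) bij(2) by simp
    moreover have "F A \<subseteq> F Rt" using F_mono[OF AR Rt_carrier] .
    ultimately have "F A = F Rt" using inj_on_image_eq_iff[OF bij(1)] by blast
    then show False using min[OF \<open>A \<subset> B\<close>] by simp
  qed
  moreover have "\<phi> ` B \<subseteq> Rt" using B(1) K_embedding_bij(1)[OF emb] by (auto simp: bij_betw_def)
  ultimately show ?thesis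
    using img[OF B(1)] B(2) bij(2) by (simp add: minimal_generating_set_def splitting_field_def)
qed

text \<open>With fewer than \<open>k\<close> elements, \<open>B\<close> would contain all roots
  lying in the field it generates. These are all roots of \<open>f\<close>, so \<open>B\<close>
  would have \<open>degree f > k\<close> elements.\<close>

lemma card_minimal_generating_set:
  assumes gen: "generic_degrees k" "k < degree f" and B: "minimal_generating_set L K f B"
  shows "k \<le> card B"
proof (rule ccontr)
  assume "\<not> k \<le> card B"
  moreover have "B \<subseteq> Rt" "F B = F Rt"
    using B by (auto simp: minimal_generating_set_def splitting_field_def)
  ultimately have "Rt \<subseteq> B"
    using generic_degrees_prefix[OF gen, of B] F_incl[of Rt] by auto
  then have "degree f \<le> card B"
    using card_roots \<open>B \<subseteq> Rt\<close> by simp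
  then show False using \<open>\<not> k \<le> card B\<close> gen(2) by linarith
qed

text \<open>Any minimal generating set has at least \<open>k\<close> elements, hence a subset of the
  size of \<open>D\<close>. A group element moving this subset onto \<open>D\<close> carries the
  whole set to a minimal generating set containing \<open>D\<close>.\<close>

lemma subset_minimal_generating_set:
  assumes trans: "k_transitive k G Rt" "k < degree f" and D: "D \<subseteq> Rt" "card D \<le> k"
  shows "\<exists>B. minimal_generating_set L K f B \<and> D \<subseteq> B"
proof -
  obtain B where B: "minimal_generating_set L K f B"
    using exists_minimal_generating_set by blast
  then have BR: "B \<subseteq> Rt" by (simp add: minimal_generating_set_def)
  have "k \<le> card B"
    using card_minimal_generating_set[OF generic_degrees_if_k_transitive[OF trans] trans(2) B] .
  then obtain A where A: "A \<subseteq> B" "card A = card D" "finite A"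
    using obtain_subset_with_card_n[of "card D" B] D(2) by auto
  obtain as where as: "set as = A" "distinct as" using finite_distinct_list[OF A(3)] by blast
  obtain ds where ds: "set ds = D" "distinct ds"
    using finite_distinct_list[OF finite_subset[OF D(1) finite_Rt]] by blast
  have len: "length as = card D" "length ds = card D"
    using as ds A(2) distinct_card by fastforce+
  have "set as \<subseteq> Rt" "set ds \<subseteq> Rt" using as ds A(1) BR D(1) by auto
  then obtain \<phi> where \<phi>: "\<phi> \<in> carrier G" "map \<phi> as = ds"
    using k_transitive_shorter[OF trans(1), of as ds] trans(2) as(2) ds(2) len D(2) by auto
  have "D = \<phi> ` A" using \<phi>(2) as(1) ds(1) by (metis set_map)
  then have "D \<subseteq> \<phi> ` B" using A(1) by blast
  then show ?thesis using minimal_generating_set_image[OF \<phi>(1) B] by blast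
qed

section \<open>Assembly of the equivalence\<close>

lemma k_transitive_iff_generic_degrees:
  assumes "k < degree f"
  shows "k_transitive k G Rt \<longleftrightarrow> generic_degrees k"
  using assms k_transitive_if_generic_degrees generic_degrees_if_k_transitive by blast

lemma generic_degrees_clusters:
  assumes "generic_degrees k" "2 \<le> k" "k < degree f"
  shows "cluster_size L K f = 1" "cluster_number L K f = degree f"
proof -
  have clusters: "root_clusters L K f = (\<lambda>\<alpha>. {\<alpha>}) ` Rt"
    using root_clusters_singletons[OF generic_degrees_singletons[OF assms]] .
  \<comment> \<open>The description of the common size is determined because there is at least one
    cluster.\<close>
  show "cluster_size L K f = 1"
    unfolding cluster_size_def clusters using Rt_not_empty by (intro the_equality) auto
  show "cluster_number L K f = degree f"
    unfolding cluster_number_def clusters card_roots[symmetric] by (intro card_image) simp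
qed

end

theorem theorem3p4:
  fixes L :: "('a, 'm) ring_scheme" and K :: "'a set" and f :: "'a list" and n k :: nat
  assumes "algebraic_closure L K"
    and "perfect L K"
    and "f \<in> carrier (K[X]\<^bsub>L\<^esub>)"
    and "pirreducible\<^bsub>L\<^esub> K f"
    and "degree f = n"
    and "n > 2"
    and "0 < k" and "k < n"
  shows "(k_transitive k (galois_group L K (splitting_field L K f)) (root_set L f) \<longleftrightarrow>
      (\<forall>B. minimal_generating_set L K f B \<longrightarrow> card B \<ge> k) \<and>
      (\<forall>D. D \<subseteq> root_set L f \<and> card D \<le> k \<longrightarrow>
         (\<forall>\<delta>\<in>D. \<delta> \<notin> adjoin L K (D - {\<delta>})) \<and>
         (\<exists>B. minimal_generating_set L K f B \<and> D \<subseteq> B)) \<and>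
      (k \<ge> 2 \<longrightarrow> cluster_size L K f = 1 \<and> cluster_number L K f = n) \<and>
      (\<forall>T\<in>cluster_towers L K f.
         tower_length T \<ge> k \<and>
         take k (degree_sequence L K T) = map (nPr n) [1..<Suc k]) \<and>
      card (cluster_towers L K f) \<ge> nPr n (k - 1))
    \<and> ((\<forall>T\<in>cluster_towers L K f.
         tower_length T \<ge> k \<and>
         take k (degree_sequence L K T) = map (nPr n) [1..<Suc k])
       \<longrightarrow> card (cluster_towers L K f) \<ge> nPr n (k - 1))"
proof -
  interpret algebraic_closure L K by (rule assms(1))
  interpret separable_irreducible L K f
    using card_roots_irreducible_perfect[OF assms(2-4)] assms(1,3,4)
    by (intro separable_irreducible.intro separable_irreducible_axioms.intro) auto
  have k: "0 < k" "k < degree f" using assms(5,7,8) by auto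
  \<comment> \<open>The tower condition and \<open>k\<close>-transitivity are both equivalent to
    \<open>generic_degrees k\<close>; the other conditions are consequences of it.\<close>
  have towers: "(\<forall>T\<in>cluster_towers L K f.
         tower_length T \<ge> k \<and>
         take k (degree_sequence L K T) = map (nPr n) [1..<Suc k]) \<longleftrightarrow> generic_degrees k"
    unfolding assms(5)[symmetric] generic_tower_def[symmetric]
    using generic_degrees_if_generic_towers[OF k] generic_tower_if_generic_degrees[OF _ k] by blast
  have independent: "\<delta> \<notin> adjoin L K (D - {\<delta>})"
    if "generic_degrees k" "D \<subseteq> root_set L f" "card D \<le> k" "\<delta> \<in> D" for D \<delta>
  proof -
    \<comment> \<open>Removing \<open>\<delta>\<close> leaves fewer than \<open>k\<close> roots even
      when \<open>card D = k\<close>.\<close>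
    have "card (D - {\<delta>}) < card D"
      using that finite_subset[OF that(2) finite_Rt] by (intro card_Diff1_less) auto
    then show ?thesis
      using that by (intro generic_degrees_not_in_F[OF that(1) k(2)]) auto
  qed
  \<comment> \<open>The last implication is again the count of towers, since its premise is
    \<open>generic_degrees k\<close> as well.\<close>
  show ?thesis
    unfolding towers k_transitive_iff_generic_degrees[OF k(2)]
    using card_minimal_generating_set[OF _ k(2)] independent
      subset_minimal_generating_set[OF iffD2[OF k_transitive_iff_generic_degrees[OF k(2)]] k(2)]
      generic_degrees_clusters[OF _ _ k(2)] card_cluster_towers[OF _ k] assms(5)
    by (smt (verit))
qed

end
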